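(* $\mathsf{EFA}\vdash(\forall m>0)\,\mathsf{BL}_{d\mapsto md}$. That is, $\mathsf{EFA}$ proves: for all $m>0$ and all $r>0$ there exists $n$ such that every coloring $C\colon n\to r$ has a $C$-homogeneous set $H$ with $|H|>m\cdot\mathrm{gs}(H)$.
   Context: $\mathsf{EFA}$ (Elementary Function Arithmetic) is the first-order theory $\mathsf{I}\Sigma_0+\exp$. For $f\colon\mathbb{N}\to\mathbb{N}$, $\mathsf{BL}_f$ is the statement: for all $r>0$ there exists $n$ such that every coloring $C\colon n\to r$ has a $C$-homogeneous set $H$ such that $|H|>f(\mathrm{gs}(H))$. Here a natural number $n$ is identified with $\{0,\dots,n-1\}$, finite sets and finite colorings are coded by numbers, a set $H\subseteq n$ is $C$-homogeneous if $C$ is constant on $H$, and the gap size $\mathrm{gs}(H)$ of a finite set $H$ is the largest difference between two consecutive elements of $H$, with $\mathrm{gs}(H)=1$ if $|H|\leq 1$. *)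

theory Defs
  imports Main
begin

section \<open>First-order logic in the language of arithmetic\<close>

datatype tm = Var nat | Zero | Succ tm
  | Add tm tm  (infixl "\<^bold>+" 85)
  | Mul tm tm  (infixl "\<^bold>*" 90)

text \<open>Variables are de Bruijn indices: in \<open>Forall \<phi>\<close> the index 0 of \<open>\<phi>\<close> is bound, and the index
  \<open>Suc i\<close> of \<open>\<phi>\<close> is the index \<open>i\<close> outside.\<close>

datatype fm = Fls
  | Eq tm tm   (infix "\<^bold>=" 80)
  | Lt tm tm   (infix "\<^bold><" 80)
  | Imp fm fm  (infixr "\<^bold>\<longrightarrow>" 60)
  | Forall fm

definition Neg :: "fm \<Rightarrow> fm" where "Neg \<phi> = (\<phi> \<^bold>\<longrightarrow> Fls)"
definition Con :: "fm \<Rightarrow> fm \<Rightarrow> fm" (infixr "\<^bold>\<and>" 70) where "\<phi> \<^bold>\<and> \<psi> = Neg (\<phi> \<^bold>\<longrightarrow> Neg \<psi>)"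
definition Dis :: "fm \<Rightarrow> fm \<Rightarrow> fm" (infixr "\<^bold>\<or>" 65) where "\<phi> \<^bold>\<or> \<psi> = (Neg \<phi> \<^bold>\<longrightarrow> \<psi>)"
definition Iff :: "fm \<Rightarrow> fm \<Rightarrow> fm" (infix "\<^bold>\<longleftrightarrow>" 55)
  where "(\<phi> \<^bold>\<longleftrightarrow> \<psi>) = ((\<phi> \<^bold>\<longrightarrow> \<psi>) \<^bold>\<and> (\<psi> \<^bold>\<longrightarrow> \<phi>))"
definition Exists :: "fm \<Rightarrow> fm" where "Exists \<phi> = Neg (Forall (Neg \<phi>))"

subsection \<open>Substitution\<close>

primrec subst_tm :: "(nat \<Rightarrow> tm) \<Rightarrow> tm \<Rightarrow> tm" where
  "subst_tm \<sigma> (Var i) = \<sigma> i"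
| "subst_tm \<sigma> Zero = Zero"
| "subst_tm \<sigma> (Succ t) = Succ (subst_tm \<sigma> t)"
| "subst_tm \<sigma> (s \<^bold>+ t) = subst_tm \<sigma> s \<^bold>+ subst_tm \<sigma> t"
| "subst_tm \<sigma> (s \<^bold>* t) = subst_tm \<sigma> s \<^bold>* subst_tm \<sigma> t"

text \<open>\<open>shift k t\<close> is the term \<open>t\<close> as it has to be written under \<open>k\<close> further quantifiers.\<close>

definition shift :: "nat \<Rightarrow> tm \<Rightarrow> tm" where
  "shift k = subst_tm (\<lambda>i. Var (i + k))"

primrec subst :: "(nat \<Rightarrow> tm) \<Rightarrow> fm \<Rightarrow> fm" where
  "subst \<sigma> Fls = Fls"
| "subst \<sigma> (s \<^bold>= t) = (subst_tm \<sigma> s \<^bold>= subst_tm \<sigma> t)"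
| "subst \<sigma> (s \<^bold>< t) = (subst_tm \<sigma> s \<^bold>< subst_tm \<sigma> t)"
| "subst \<sigma> (\<phi> \<^bold>\<longrightarrow> \<psi>) = (subst \<sigma> \<phi> \<^bold>\<longrightarrow> subst \<sigma> \<psi>)"
| "subst \<sigma> (Forall \<phi>) = Forall (subst (case_nat (Var 0) (shift 1 \<circ> \<sigma>)) \<phi>)"

definition shift_fm :: "fm \<Rightarrow> fm" where
  "shift_fm = subst (\<lambda>i. Var (Suc i))"

text \<open>\<open>inst t \<phi>\<close> replaces the index 0 by \<open>t\<close> and drops the corresponding binder.\<close>

definition inst :: "tm \<Rightarrow> fm \<Rightarrow> fm" where
  "inst t = subst (case_nat t Var)"

subsection \<open>Provability\<close>

text \<open>Classical natural deduction with equality. The set on the left contains the axioms of the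
  theory together with the open assumptions; shifting it in \<open>ForallI\<close> makes the index 0 fresh.\<close>

inductive prv :: "fm set \<Rightarrow> fm \<Rightarrow> bool" (infix "\<turnstile>" 50) where
  Assm: "\<phi> \<in> \<Gamma> \<Longrightarrow> \<Gamma> \<turnstile> \<phi>"
| ImpI: "insert \<phi> \<Gamma> \<turnstile> \<psi> \<Longrightarrow> \<Gamma> \<turnstile> \<phi> \<^bold>\<longrightarrow> \<psi>"
| ImpE: "\<Gamma> \<turnstile> \<phi> \<^bold>\<longrightarrow> \<psi> \<Longrightarrow> \<Gamma> \<turnstile> \<phi> \<Longrightarrow> \<Gamma> \<turnstile> \<psi>"
| Raa: "insert (Neg \<phi>) \<Gamma> \<turnstile> Fls \<Longrightarrow> \<Gamma> \<turnstile> \<phi>"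
| ForallI: "shift_fm ` \<Gamma> \<turnstile> \<phi> \<Longrightarrow> \<Gamma> \<turnstile> Forall \<phi>"
| ForallE: "\<Gamma> \<turnstile> Forall \<phi> \<Longrightarrow> \<Gamma> \<turnstile> inst t \<phi>"
| EqRefl: "\<Gamma> \<turnstile> t \<^bold>= t"
| EqSubst: "\<Gamma> \<turnstile> s \<^bold>= t \<Longrightarrow> \<Gamma> \<turnstile> inst s \<phi> \<Longrightarrow> \<Gamma> \<turnstile> inst t \<phi>"

subsection \<open>Universal closure\<close>

primrec bound_tm :: "tm \<Rightarrow> nat" where
  "bound_tm (Var i) = Suc i"
| "bound_tm Zero = 0"
| "bound_tm (Succ t) = bound_tm t"
| "bound_tm (s \<^bold>+ t) = max (bound_tm s) (bound_tm t)"
| "bound_tm (s \<^bold>* t) = max (bound_tm s) (bound_tm t)"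

text \<open>\<open>bound \<phi>\<close> is the least \<open>k\<close> such that all free indices of \<open>\<phi>\<close> are below \<open>k\<close>.\<close>

primrec bound :: "fm \<Rightarrow> nat" where
  "bound Fls = 0"
| "bound (s \<^bold>= t) = max (bound_tm s) (bound_tm t)"
| "bound (s \<^bold>< t) = max (bound_tm s) (bound_tm t)"
| "bound (\<phi> \<^bold>\<longrightarrow> \<psi>) = max (bound \<phi>) (bound \<psi>)"
| "bound (Forall \<phi>) = bound \<phi> - 1"

definition closure :: "fm \<Rightarrow> fm" where
  "closure \<phi> = (Forall ^^ bound \<phi>) \<phi>"


section \<open>Elementary Function Arithmetic\<close>

abbreviation One :: tm where "One \<equiv> Succ Zero"
abbreviation Two :: tm where "Two \<equiv> Succ One"

definition Robinson :: "fm set" where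
  "Robinson =
    {Neg (Succ (Var 0) \<^bold>= Zero),
     Succ (Var 0) \<^bold>= Succ (Var 1) \<^bold>\<longrightarrow> Var 0 \<^bold>= Var 1,
     Neg (Var 0 \<^bold>= Zero) \<^bold>\<longrightarrow> Exists (Var 1 \<^bold>= Succ (Var 0)),
     Var 0 \<^bold>+ Zero \<^bold>= Var 0,
     Var 0 \<^bold>+ Succ (Var 1) \<^bold>= Succ (Var 0 \<^bold>+ Var 1),
     Var 0 \<^bold>* Zero \<^bold>= Zero,
     Var 0 \<^bold>* Succ (Var 1) \<^bold>= Var 0 \<^bold>* Var 1 \<^bold>+ Var 0,
     Var 0 \<^bold>< Var 1 \<^bold>\<longleftrightarrow> Exists (Succ (Var 0) \<^bold>+ Var 1 \<^bold>= Var 2)}"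

text \<open>Bounded quantifiers: the bound \<open>t\<close> is written outside the scope of the quantifier, so it
  cannot mention the quantified variable.\<close>

definition BAll :: "tm \<Rightarrow> fm \<Rightarrow> fm" where
  "BAll t \<phi> = Forall (Var 0 \<^bold>< shift 1 t \<^bold>\<longrightarrow> \<phi>)"
definition BEx :: "tm \<Rightarrow> fm \<Rightarrow> fm" where
  "BEx t \<phi> = Neg (BAll t (Neg \<phi>))"

inductive Sigma0 :: "fm \<Rightarrow> bool" where
  "Sigma0 Fls"
| "Sigma0 (s \<^bold>= t)"
| "Sigma0 (s \<^bold>< t)"
| "Sigma0 \<phi> \<Longrightarrow> Sigma0 \<psi> \<Longrightarrow> Sigma0 (\<phi> \<^bold>\<longrightarrow> \<psi>)"
| "Sigma0 \<phi> \<Longrightarrow> Sigma0 (BAll t \<phi>)"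

text \<open>Induction on the index 0 of \<open>\<phi>\<close>; the other free indices are parameters.\<close>

definition Induction :: "fm \<Rightarrow> fm" where
  "Induction \<phi> =
    (inst Zero \<phi>
     \<^bold>\<longrightarrow> Forall (\<phi> \<^bold>\<longrightarrow> subst (case_nat (Succ (Var 0)) (\<lambda>i. Var (Suc i))) \<phi>)
     \<^bold>\<longrightarrow> Forall \<phi>)"

definition ISigma0 :: "fm set" where
  "ISigma0 = closure ` (Robinson \<union> {Induction \<phi> |\<phi>. Sigma0 \<phi>})"

text \<open>\<open>Beta a b i v\<close> says that \<open>v\<close> is the remainder of \<open>a\<close> modulo \<open>(i + 1) b + 1\<close>, i.e. that \<open>v\<close> is
  entry \<open>i\<close> of the sequence coded by \<open>(a, b)\<close> through Goedel's beta function.\<close>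

definition Beta :: "tm \<Rightarrow> tm \<Rightarrow> tm \<Rightarrow> tm \<Rightarrow> fm" where
  "Beta a b i v =
    (v \<^bold>< Succ (Succ i \<^bold>* b)
     \<^bold>\<and> BEx (Succ a) (shift 1 a \<^bold>= Var 0 \<^bold>* Succ (Succ (shift 1 i) \<^bold>* shift 1 b) \<^bold>+ shift 1 v))"

text \<open>\<open>y = 2\<^sup>x\<close>: some sequence starts with 1, doubles at each of the first \<open>x\<close> steps, and has \<open>y\<close> as
  its entry \<open>x\<close>. Under the outer quantifiers, \<open>Var 1\<close> and \<open>Var 0\<close> code the sequence.\<close>

definition Pow2 :: "tm \<Rightarrow> tm \<Rightarrow> fm" where
  "Pow2 x y = Exists (Exists
    (Beta (Var 1) (Var 0) Zero One
     \<^bold>\<and> BAll (shift 2 x)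
          (Exists (Beta (Var 3) (Var 2) (Var 1) (Var 0)
                   \<^bold>\<and> Beta (Var 3) (Var 2) (Succ (Var 1)) (Two \<^bold>* Var 0)))
     \<^bold>\<and> Beta (Var 1) (Var 0) (shift 2 x) (shift 2 y)))"

text \<open>There is no symbol for exponentiation, so the induction scheme only covers bounded formulas in
  zero, successor, sum, product and order; the axiom states that \<open>2\<^sup>x\<close> exists for every \<open>x\<close>.\<close>

definition Exp :: fm where
  "Exp = Forall (Exists (Pow2 (Var 1) (Var 0)))"

definition EFA :: "fm set" where
  "EFA = insert Exp ISigma0"


section \<open>Homogeneous sets with small gaps\<close>

text \<open>Sequences are coded by the beta function. A pair \<open>(a, b)\<close> codes the coloring of \<open>n\<close> given by the
  first \<open>n\<close> entries of its sequence, and a pair \<open>(c, d)\<close> codes the subset of \<open>n\<close> consisting of the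
  \<open>x < n\<close> whose entry is 1.\<close>

definition Coloring :: "tm \<Rightarrow> tm \<Rightarrow> tm \<Rightarrow> tm \<Rightarrow> fm" where
  "Coloring a b n r = BAll n (BEx (shift 1 r) (Beta (shift 2 a) (shift 2 b) (Var 1) (Var 0)))"

definition Mem :: "tm \<Rightarrow> tm \<Rightarrow> tm \<Rightarrow> tm \<Rightarrow> fm" where
  "Mem x c d n = (x \<^bold>< n \<^bold>\<and> Beta c d x One)"

text \<open>In the quantifier prefix, \<open>Var 1\<close> and \<open>Var 0\<close> are two elements of the set; in the innermost scope
  they become \<open>Var 2\<close> and \<open>Var 1\<close>, and \<open>Var 0\<close> is their common color.\<close>

definition Homogeneous :: "tm \<Rightarrow> tm \<Rightarrow> tm \<Rightarrow> tm \<Rightarrow> tm \<Rightarrow> tm \<Rightarrow> fm" where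
  "Homogeneous a b r c d n =
    BAll n (BAll (shift 1 n)
      (Mem (Var 1) (shift 2 c) (shift 2 d) (shift 2 n)
       \<^bold>\<and> Mem (Var 0) (shift 2 c) (shift 2 d) (shift 2 n)
       \<^bold>\<longrightarrow> BEx (shift 2 r)
            (Beta (shift 3 a) (shift 3 b) (Var 2) (Var 0)
             \<^bold>\<and> Beta (shift 3 a) (shift 3 b) (Var 1) (Var 0))))"

text \<open>The set has cardinality \<open>l\<close> if the first \<open>l\<close> entries of some sequence (coded by \<open>Var 1\<close> and
  \<open>Var 0\<close> under the two outer quantifiers) are in the set, are pairwise different and exhaust it.\<close>

definition Card :: "tm \<Rightarrow> tm \<Rightarrow> tm \<Rightarrow> tm \<Rightarrow> fm" where
  "Card c d n l = Exists (Exists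
    (BAll (shift 2 l) (BEx (shift 3 n)
       (Beta (Var 3) (Var 2) (Var 1) (Var 0)
        \<^bold>\<and> Mem (Var 0) (shift 4 c) (shift 4 d) (shift 4 n)))
     \<^bold>\<and> BAll (shift 2 l) (BAll (shift 3 l) (BAll (shift 4 n)
         (Beta (Var 4) (Var 3) (Var 2) (Var 0)
          \<^bold>\<and> Beta (Var 4) (Var 3) (Var 1) (Var 0)
          \<^bold>\<longrightarrow> Var 2 \<^bold>= Var 1)))
     \<^bold>\<and> BAll (shift 2 n)
         (Mem (Var 0) (shift 3 c) (shift 3 d) (shift 3 n)
          \<^bold>\<longrightarrow> BEx (shift 3 l) (Beta (Var 3) (Var 2) (Var 0) (Var 1)))))"

definition Consecutive :: "tm \<Rightarrow> tm \<Rightarrow> tm \<Rightarrow> tm \<Rightarrow> tm \<Rightarrow> fm" where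
  "Consecutive x y c d n =
    (Mem x c d n \<^bold>\<and> Mem y c d n \<^bold>\<and> x \<^bold>< y
     \<^bold>\<and> BAll y (shift 1 x \<^bold>< Var 0 \<^bold>\<longrightarrow> Neg (Mem (Var 0) (shift 1 c) (shift 1 d) (shift 1 n))))"

text \<open>The gap size is \<open>g\<close>. First disjunct: at most one element; second disjunct: \<open>g\<close> is attained as a
  difference of consecutive elements \<open>Var 1 < Var 0\<close> and no such difference exceeds \<open>g\<close>.\<close>

definition Gap_Size :: "tm \<Rightarrow> tm \<Rightarrow> tm \<Rightarrow> tm \<Rightarrow> fm" where
  "Gap_Size c d n g =
    (BAll n (BAll (shift 1 n)
       (Mem (Var 1) (shift 2 c) (shift 2 d) (shift 2 n)
        \<^bold>\<and> Mem (Var 0) (shift 2 c) (shift 2 d) (shift 2 n)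
        \<^bold>\<longrightarrow> Var 1 \<^bold>= Var 0))
     \<^bold>\<and> g \<^bold>= One)
    \<^bold>\<or>
    (BEx n (BEx (shift 1 n)
       (Consecutive (Var 1) (Var 0) (shift 2 c) (shift 2 d) (shift 2 n)
        \<^bold>\<and> Var 0 \<^bold>= Var 1 \<^bold>+ shift 2 g))
     \<^bold>\<and> BAll n (BAll (shift 1 n)
          (Consecutive (Var 1) (Var 0) (shift 2 c) (shift 2 d) (shift 2 n)
           \<^bold>\<longrightarrow> Var 0 \<^bold>< Succ (Var 1 \<^bold>+ shift 2 g))))"

text \<open>\<open>BL f\<close> is the statement for the function \<open>d \<mapsto> f\<close>, where \<open>f\<close> is a term in which the index 0
  stands for \<open>d\<close> and the index \<open>Suc i\<close> for the parameter \<open>Var i\<close> of \<open>BL f\<close>. The quantified variables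
  are, from the outside: \<open>r\<close>, \<open>n\<close>, the code \<open>a\<close>, \<open>b\<close> of the coloring, the code \<open>c\<close>, \<open>d\<close> of the
  homogeneous set, its cardinality \<open>l\<close> and its gap size \<open>g\<close>.\<close>

definition BL :: "tm \<Rightarrow> fm" where
  "BL f =
    Forall (Zero \<^bold>< Var 0 \<^bold>\<longrightarrow>
      Exists (Forall (Forall (Coloring (Var 1) (Var 0) (Var 2) (Var 3) \<^bold>\<longrightarrow>
        Exists (Exists
          (Homogeneous (Var 3) (Var 2) (Var 5) (Var 1) (Var 0) (Var 4)
           \<^bold>\<and> Exists (Exists
               (Card (Var 3) (Var 2) (Var 6) (Var 1)
                \<^bold>\<and> Gap_Size (Var 3) (Var 2) (Var 6) (Var 0)
                \<^bold>\<and> subst_tm (case_nat (Var 0) (\<lambda>i. Var (i + 8))) f \<^bold>< Var 1))))))))"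

end

theory Submission
  imports Defs "HOL-Library.Countable_Set"
begin

text \<open>By completeness it suffices to argue in an arbitrary model of EFA. There \<open>2\<^sup>x\<close> exists, which bounds
  the quantifiers in the usual proof, by the Chinese remainder theorem, that every \<open>\<Sigma>\<^sub>0\<close>-definable
  bounded function has a code; hence exponentials and coded sequences may be used in bounded induction.

  Put \<open>K = 2\<^bsup>m+1\<^esup>\<close>, \<open>L 0 = 1\<close>, \<open>L (j + 1) = K (L j)\<^sup>2\<close> and \<open>n = L r\<close>, that is \<open>L j = 2\<^bsup>(m+1)(2^j - 1)\<^esup>\<close>. Cut
  an interval of length \<open>L (j + 1)\<close> into \<open>T = K L j\<close> blocks of length \<open>l = L j\<close>. If some color meets all
  blocks, its least elements in the blocks form a homogeneous set of size \<open>T\<close> with gaps at most \<open>2 l\<close>, and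
  \<open>2 m l < K l = T\<close>. Otherwise every color misses some block, and passing to a block eliminates one
  color. After \<open>r\<close> steps an interval of length 1 without any color would remain.\<close>

section \<open>Substitution\<close>

text \<open>Exponentiation is not a symbol, so \<open>e x\<close> may occur in no induction formula.
  An induction that speaks of powers of two first fixes a beta code \<open>(a, b)\<close> of
  \<open>e 0, ..., e X\<close>, with \<open>X\<close> chosen large enough in advance;
  \<open>\<exists>w\<le>a. beta a b i w \<and> ...\<close> then refers to the power \<open>w\<close>
  by a bounded formula with parameters \<open>a\<close> and \<open>b\<close>. The same device bounds
  the existential quantifiers whose witnesses grow during the induction.

  The lengths \<open>L j\<close> cannot be built by simply iterating their recursion, since the
  existence of a sequence satisfying it is an unbounded statement. Their closed form is read off a
  code of powers of two, which gives a Sigma0 graph and an explicit bound; coding produces the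
  sequence afterwards. This is why \<open>K\<close> is a power of two; the exponent
  \<open>m + 1\<close> is enough to make it exceed \<open>2 m\<close>.

  The elements of a model are turned into a type, so that the library's laws of ordered semirings
  apply to a nonstandard model as well.\<close>

definition lift :: "(nat \<Rightarrow> tm) \<Rightarrow> nat \<Rightarrow> tm" where
  "lift \<sigma> = case_nat (Var 0) (shift 1 \<circ> \<sigma>)"

lemma lift_simps [simp]: "lift \<sigma> 0 = Var 0" "lift \<sigma> (Suc i) = shift 1 (\<sigma> i)"
  by (simp_all add: lift_def)

lemma subst_Forall: "subst \<sigma> (Forall \<phi>) = Forall (subst (lift \<sigma>) \<phi>)"
  by (simp add: lift_def)

lemma subst_tm_comp: "subst_tm \<sigma> (subst_tm \<tau> t) = subst_tm (\<lambda>i. subst_tm \<sigma> (\<tau> i)) t"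
  by (induction t) auto

lemma shift_simps [simp]:
  "shift k (Var i) = Var (i + k)" "shift k Zero = Zero" "shift k (Succ t) = Succ (shift k t)"
  "shift k (s \<^bold>+ t) = shift k s \<^bold>+ shift k t" "shift k (s \<^bold>* t) = shift k s \<^bold>* shift k t"
  by (simp_all add: shift_def)

lemma subst_tm_lift_shift: "subst_tm (lift \<sigma>) (shift 1 t) = shift 1 (subst_tm \<sigma> t)"
  by (induction t) simp_all

lemma subst_comp: "subst \<sigma> (subst \<tau> \<phi>) = subst (\<lambda>i. subst_tm \<sigma> (\<tau> i)) \<phi>"
proof (induction \<phi> arbitrary: \<sigma> \<tau>)
  case (Forall \<phi>)
  have "(\<lambda>i. subst_tm (lift \<sigma>) (lift \<tau> i)) = lift (\<lambda>i. subst_tm \<sigma> (\<tau> i))"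
  proof
    fix i show "subst_tm (lift \<sigma>) (lift \<tau> i) = lift (\<lambda>i. subst_tm \<sigma> (\<tau> i)) i"
      by (cases i) (simp_all only: lift_simps subst_tm_lift_shift subst_tm.simps)
  qed
  then show ?case by (simp only: subst_Forall Forall)
qed (auto simp: subst_tm_comp)

lemma subst_tm_cong: "(\<And>i. i < bound_tm t \<Longrightarrow> \<sigma> i = \<tau> i) \<Longrightarrow> subst_tm \<sigma> t = subst_tm \<tau> t"
  by (induction t) auto

lemma subst_cong: "(\<And>i. i < bound \<phi> \<Longrightarrow> \<sigma> i = \<tau> i) \<Longrightarrow> subst \<sigma> \<phi> = subst \<tau> \<phi>"
proof (induction \<phi> arbitrary: \<sigma> \<tau>)
  case (Forall \<phi>)
  have "lift \<sigma> i = lift \<tau> i" if "i < bound \<phi>" for i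
    using that Forall.prems by (cases i) auto
  then have "subst (lift \<sigma>) \<phi> = subst (lift \<tau>) \<phi>" by (rule Forall.IH)
  then show ?case by (simp only: subst_Forall)
next
  case (Imp \<phi> \<psi>)
  have "subst \<sigma> \<phi> = subst \<tau> \<phi>" by (rule Imp.IH(1)) (simp add: Imp.prems)
  moreover have "subst \<sigma> \<psi> = subst \<tau> \<psi>" by (rule Imp.IH(2)) (simp add: Imp.prems)
  ultimately show ?case by simp
qed (auto intro!: subst_tm_cong)

lemma subst_tm_Var [simp]: "subst_tm Var t = t"
  by (induction t) auto

lemma lift_Var [simp]: "lift Var = Var"
proof
  show "lift Var i = Var i" for i by (cases i) auto
qed

lemma subst_Var [simp]: "subst Var \<phi> = \<phi>"
  by (induction \<phi>) (simp_all add: subst_Forall del: subst.simps(5))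

lemma subst_tm_inst_shift [simp]: "subst_tm (case_nat t \<tau>) (shift 1 s) = subst_tm \<tau> s"
  by (induction s) auto

lemma inst_subst_lift: "inst t (subst (lift \<sigma>) \<phi>) = subst (case_nat t \<sigma>) \<phi>"
proof -
  have "(\<lambda>i. subst_tm (case_nat t Var) (lift \<sigma> i)) = case_nat t \<sigma>"
  proof
    show "subst_tm (case_nat t Var) (lift \<sigma> i) = case_nat t \<sigma> i" for i
      by (cases i) (simp_all del: One_nat_def)
  qed
  then show ?thesis by (simp add: inst_def subst_comp)
qed

lemma subst_inst: "subst \<sigma> (inst t \<phi>) = inst (subst_tm \<sigma> t) (subst (lift \<sigma>) \<phi>)"
proof -
  have "(\<lambda>i. subst_tm \<sigma> (case_nat t Var i)) = case_nat (subst_tm \<sigma> t) \<sigma>"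
    by (auto split: nat.split)
  then show ?thesis unfolding inst_subst_lift by (simp add: inst_def subst_comp)
qed

lemma subst_shift_fm: "subst (lift \<sigma>) (shift_fm \<phi>) = shift_fm (subst \<sigma> \<phi>)"
proof -
  have "(\<lambda>i. subst_tm (lift \<sigma>) (Var (Suc i))) = (\<lambda>i. subst_tm (\<lambda>i. Var (Suc i)) (\<sigma> i))"
    by (auto simp: shift_def)
  then show ?thesis by (simp add: shift_fm_def subst_comp)
qed

lemma subst_Neg [simp]: "subst \<sigma> (Neg \<phi>) = Neg (subst \<sigma> \<phi>)"
  by (simp add: Neg_def)

section \<open>Derivations\<close>

lemma prv_weaken: "\<Gamma> \<turnstile> \<phi> \<Longrightarrow> \<Gamma> \<subseteq> \<Delta> \<Longrightarrow> \<Delta> \<turnstile> \<phi>"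
proof (induction arbitrary: \<Delta> rule: prv.induct)
  case (Assm \<phi> \<Gamma>) then show ?case by (auto intro: prv.Assm)
next
  case (ImpI \<phi> \<Gamma> \<psi>) then show ?case by (meson prv.ImpI insert_mono)
next
  case (ImpE \<Gamma> \<phi> \<psi>) then show ?case by (blast intro: prv.ImpE)
next
  case (Raa \<phi> \<Gamma>) then show ?case by (meson prv.Raa insert_mono)
next
  case (ForallI \<Gamma> \<phi>) then show ?case by (simp add: prv.ForallI image_mono)
next
  case (ForallE \<Gamma> \<phi> t) then show ?case by (blast intro: prv.ForallE)
next
  case (EqRefl \<Gamma> t) then show ?case by (blast intro: prv.EqRefl)
next
  case (EqSubst \<Gamma> s t \<phi>) then show ?case by (blast intro: prv.EqSubst)
qed

text \<open>In the quantifier rule the shifted assumptions remain shifted, by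
  \<open>subst_shift_fm\<close>. The lemma serves to rename a fresh variable to the index 0.\<close>

lemma prv_subst: "\<Gamma> \<turnstile> \<phi> \<Longrightarrow> subst \<sigma> ` \<Gamma> \<turnstile> subst \<sigma> \<phi>"
proof (induction arbitrary: \<sigma> rule: prv.induct)
  case (Assm \<phi> \<Gamma>) then show ?case by (auto intro: prv.Assm)
next
  case (ImpI \<phi> \<Gamma> \<psi>) then show ?case by (simp add: prv.ImpI)
next
  case (ImpE \<Gamma> \<phi> \<psi>) then show ?case by (auto intro: prv.ImpE)
next
  case (Raa \<phi> \<Gamma>)
  from Raa.IH[of \<sigma>] show ?case by (simp add: prv.Raa)
next
  case (ForallI \<Gamma> \<phi>)
  have "subst (lift \<sigma>) ` shift_fm ` \<Gamma> = shift_fm ` subst \<sigma> ` \<Gamma>"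
    by (simp add: image_image subst_shift_fm)
  with ForallI.IH[of "lift \<sigma>"] show ?case by (simp add: subst_Forall prv.ForallI del: subst.simps)
next
  case (ForallE \<Gamma> \<phi> t)
  from ForallE.IH[of \<sigma>] show ?case
    by (simp only: subst_inst subst_Forall prv.ForallE)
next
  case (EqRefl \<Gamma> t) then show ?case by (simp add: prv.EqRefl)
next
  case (EqSubst \<Gamma> s t \<phi>)
  from EqSubst.IH(1)[of \<sigma>] EqSubst.IH(2)[of \<sigma>] show ?case
    unfolding subst_inst subst.simps by (rule prv.EqSubst)
qed

text \<open>Needed to pass consistency to the union of a chain. A discharged assumption is first
  removed from the finite set, so that what remains lies in \<open>\<Gamma>\<close>.\<close>

lemma prv_finite: "\<Gamma> \<turnstile> \<phi> \<Longrightarrow> \<exists>\<Gamma>'. finite \<Gamma>' \<and> \<Gamma>' \<subseteq> \<Gamma> \<and> \<Gamma>' \<turnstile> \<phi>"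
proof (induction rule: prv.induct)
  case (Assm \<phi> \<Gamma>) then show ?case by (intro exI[of _ "{\<phi>}"]) (auto intro: prv.Assm)
next
  case (ImpI \<phi> \<Gamma> \<psi>)
  then obtain \<Delta> where D: "finite \<Delta>" "\<Delta> \<subseteq> insert \<phi> \<Gamma>" "\<Delta> \<turnstile> \<psi>" by blast
  then have "insert \<phi> (\<Delta> - {\<phi>}) \<turnstile> \<psi>" by (auto elim: prv_weaken)
  then show ?case using D by (intro exI[of _ "\<Delta> - {\<phi>}"]) (auto intro: prv.ImpI)
next
  case (ImpE \<Gamma> \<phi> \<psi>)
  then obtain \<Delta> \<Delta>' where D: "finite \<Delta>" "\<Delta> \<subseteq> \<Gamma>" "\<Delta> \<turnstile> \<phi> \<^bold>\<longrightarrow> \<psi>" "finite \<Delta>'" "\<Delta>' \<subseteq> \<Gamma>" "\<Delta>' \<turnstile> \<phi>"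
    by blast
  then have "\<Delta> \<union> \<Delta>' \<turnstile> \<psi>" by (meson prv.ImpE prv_weaken sup_ge1 sup_ge2)
  then show ?case using D by (intro exI[of _ "\<Delta> \<union> \<Delta>'"]) auto
next
  case (Raa \<phi> \<Gamma>)
  then obtain \<Delta> where D: "finite \<Delta>" "\<Delta> \<subseteq> insert (Neg \<phi>) \<Gamma>" "\<Delta> \<turnstile> Fls" by blast
  then have "insert (Neg \<phi>) (\<Delta> - {Neg \<phi>}) \<turnstile> Fls" by (auto elim: prv_weaken)
  then show ?case using D by (intro exI[of _ "\<Delta> - {Neg \<phi>}"]) (auto intro: prv.Raa)
next
  case (ForallI \<Gamma> \<phi>)
  then obtain \<Delta> where D: "finite \<Delta>" "\<Delta> \<subseteq> shift_fm ` \<Gamma>" "\<Delta> \<turnstile> \<phi>" by blast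
  then obtain \<Delta>' where "\<Delta>' \<subseteq> \<Gamma>" "finite \<Delta>'" "\<Delta> = shift_fm ` \<Delta>'"
    by (meson finite_subset_image)
  then show ?case using D by (intro exI[of _ \<Delta>']) (auto intro: prv.ForallI)
next
  case (ForallE \<Gamma> \<phi> t) then show ?case by (blast intro: prv.ForallE)
next
  case (EqRefl \<Gamma> t) then show ?case by (blast intro: prv.EqRefl)
next
  case (EqSubst \<Gamma> s t \<phi>)
  then obtain \<Delta> \<Delta>' where D: "finite \<Delta>" "\<Delta> \<subseteq> \<Gamma>" "\<Delta> \<turnstile> s \<^bold>= t" "finite \<Delta>'" "\<Delta>' \<subseteq> \<Gamma>" "\<Delta>' \<turnstile> inst s \<phi>"
    by blast
  then have "\<Delta> \<union> \<Delta>' \<turnstile> inst t \<phi>" by (meson prv.EqSubst prv_weaken sup_ge1 sup_ge2)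
  then show ?case using D by (intro exI[of _ "\<Delta> \<union> \<Delta>'"]) auto
qed

lemma prv_cut: "insert \<phi> \<Gamma> \<turnstile> \<psi> \<Longrightarrow> \<Gamma> \<turnstile> \<phi> \<Longrightarrow> \<Gamma> \<turnstile> \<psi>"
  by (meson prv.ImpI prv.ImpE)

lemma prv_NegE: "\<Gamma> \<turnstile> Neg \<phi> \<Longrightarrow> \<Gamma> \<turnstile> \<phi> \<Longrightarrow> \<Gamma> \<turnstile> Fls"
  unfolding Neg_def by (rule prv.ImpE)

lemma prv_NegI: "insert \<phi> \<Gamma> \<turnstile> Fls \<Longrightarrow> \<Gamma> \<turnstile> Neg \<phi>"
  unfolding Neg_def by (rule prv.ImpI)

text \<open>A free variable that does not occur in \<open>\<Gamma>\<close> and \<open>\<psi>\<close> is renamed to the index 0, which turns \<open>\<Gamma>\<close>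
  into its shift.\<close>

lemma prv_generalize:
  assumes "\<And>\<phi>. \<phi> \<in> \<Gamma> \<Longrightarrow> bound \<phi> \<le> k" "bound \<psi> \<le> k" "\<Gamma> \<turnstile> inst (Var k) \<psi>"
  shows "\<Gamma> \<turnstile> Forall \<psi>"
proof -
  define \<sigma> where "\<sigma> i = (if i = k then Var 0 else Var (Suc i))" for i
  have "subst \<sigma> \<phi> = shift_fm \<phi>" if "\<phi> \<in> \<Gamma>" for \<phi>
    unfolding shift_fm_def using assms(1)[OF that] by (intro subst_cong) (auto simp: \<sigma>_def)
  then have "subst \<sigma> ` \<Gamma> = shift_fm ` \<Gamma>" by force
  moreover have "subst \<sigma> (inst (Var k) \<psi>) = subst Var \<psi>"
    unfolding inst_def subst_comp
  proof (intro subst_cong)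
    show "subst_tm \<sigma> (case_nat (Var k) Var i) = Var i" if "i < bound \<psi>" for i
      using that assms(2) by (auto simp: \<sigma>_def split: nat.split)
  qed
  ultimately have "shift_fm ` \<Gamma> \<turnstile> \<psi>" using prv_subst[OF assms(3), of \<sigma>] by simp
  then show ?thesis by (rule prv.ForallI)
qed

section \<open>Completeness\<close>

instance tm :: countable by countable_datatype
instance fm :: countable by countable_datatype

section \<open>Maximal consistent sets with variables as witnesses\<close>

definition consistent :: "fm set \<Rightarrow> bool" where "consistent \<Gamma> \<longleftrightarrow> \<not> \<Gamma> \<turnstile> Fls"

text \<open>Guarantees a fresh variable at every stage: sentences have no free index and each stage
  adds finitely many formulas. Variables can therefore serve as Henkin constants.\<close>

definition bounded_vars :: "fm set \<Rightarrow> bool" where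
  "bounded_vars \<Gamma> \<longleftrightarrow> (\<exists>k. \<forall>\<phi>\<in>\<Gamma>. bound \<phi> \<le> k)"

lemma bounded_vars_insert: "bounded_vars \<Gamma> \<Longrightarrow> bounded_vars (insert \<phi> \<Gamma>)"
  unfolding bounded_vars_def by (metis insert_iff max.cobounded1 max.cobounded2 max.coboundedI1)

text \<open>For fresh \<open>k\<close>, a refutation of the negated instance proves the instance,
  and generalizing it contradicts the negated universal formula.\<close>

lemma consistent_witness:
  assumes "bounded_vars \<Gamma>" "consistent \<Gamma>" "Neg (Forall \<psi>) \<in> \<Gamma>"
  shows "\<exists>k. consistent (insert (Neg (inst (Var k) \<psi>)) \<Gamma>)"
proof -
  have "bounded_vars (insert \<psi> \<Gamma>)" using assms(1) by (rule bounded_vars_insert)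
  then obtain k where k: "\<And>\<phi>. \<phi> \<in> \<Gamma> \<Longrightarrow> bound \<phi> \<le> k" "bound \<psi> \<le> k"
    unfolding bounded_vars_def by auto
  have False if "insert (Neg (inst (Var k) \<psi>)) \<Gamma> \<turnstile> Fls"
  proof -
    have "\<Gamma> \<turnstile> Forall \<psi>" using prv.Raa[OF that] prv_generalize[OF k] by blast
    then show False using assms(2,3) prv_NegE prv.Assm unfolding consistent_def by blast
  qed
  then show ?thesis unfolding consistent_def by blast
qed

lemma consistent_step:
  assumes "bounded_vars \<Gamma>" "consistent \<Gamma>"
  shows "\<exists>\<Delta>. \<Gamma> \<subseteq> \<Delta> \<and> bounded_vars \<Delta> \<and> consistent \<Delta> \<and> (\<phi> \<in> \<Delta> \<or> Neg \<phi> \<in> \<Delta>)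
    \<and> (\<forall>\<psi>. \<phi> = Forall \<psi> \<longrightarrow> \<phi> \<in> \<Delta> \<or> (\<exists>k. Neg (inst (Var k) \<psi>) \<in> \<Delta>))"
proof (cases "consistent (insert \<phi> \<Gamma>)")
  case True
  with assms show ?thesis by (intro exI[of _ "insert \<phi> \<Gamma>"]) (auto intro: bounded_vars_insert)
next
  case False
  then have "\<Gamma> \<turnstile> Neg \<phi>" by (simp add: consistent_def prv_NegI)
  then have con: "consistent (insert (Neg \<phi>) \<Gamma>)"
    using assms(2) prv_cut unfolding consistent_def by blast
  show ?thesis
  proof (cases "\<exists>\<psi>. \<phi> = Forall \<psi>")
    case True
    then obtain \<psi> where psi: "\<phi> = Forall \<psi>" by blast
    obtain k where "consistent (insert (Neg (inst (Var k) \<psi>)) (insert (Neg \<phi>) \<Gamma>))"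
      using consistent_witness[OF bounded_vars_insert[OF assms(1)] con] psi by blast
    then show ?thesis using psi assms
      by (intro exI[of _ "insert (Neg (inst (Var k) \<psi>)) (insert (Neg \<phi>) \<Gamma>)"])
        (auto intro: bounded_vars_insert)
  next
    case False
    with con assms show ?thesis
      by (intro exI[of _ "insert (Neg \<phi>) \<Gamma>"]) (auto intro: bounded_vars_insert)
  qed
qed

definition henkin :: "fm set \<Rightarrow> bool" where
  "henkin S \<longleftrightarrow> consistent S \<and> (\<forall>\<phi>. \<phi> \<in> S \<or> Neg \<phi> \<in> S)
    \<and> (\<forall>\<psi>. Forall \<psi> \<in> S \<or> (\<exists>k. Neg (inst (Var k) \<psi>) \<in> S))"

lemma henkin_extension:
  assumes "bounded_vars \<Gamma>" "consistent \<Gamma>"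
  shows "\<exists>S. \<Gamma> \<subseteq> S \<and> henkin S"
proof -
  define step where "step \<phi> \<Gamma> \<Delta> \<longleftrightarrow> \<Gamma> \<subseteq> \<Delta> \<and> bounded_vars \<Delta> \<and> consistent \<Delta> \<and> (\<phi> \<in> \<Delta> \<or> Neg \<phi> \<in> \<Delta>)
    \<and> (\<forall>\<psi>. \<phi> = Forall \<psi> \<longrightarrow> \<phi> \<in> \<Delta> \<or> (\<exists>k. Neg (inst (Var k) \<psi>) \<in> \<Delta>))" for \<phi> \<Gamma> \<Delta>
  define ok where "ok \<Gamma> \<longleftrightarrow> bounded_vars \<Gamma> \<and> consistent \<Gamma>" for \<Gamma>
  \<comment> \<open>The clause for \<open>n = 0\<close> pins the start of the chain, which dependent
    choice leaves open.\<close>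
  have "\<exists>f. \<forall>n. (ok (f n) \<and> (n = 0 \<longrightarrow> f n = \<Gamma>)) \<and> step (from_nat n) (f n) (f (Suc n))"
  proof (rule dependent_nat_choice)
    show "\<exists>\<Delta>. ok \<Delta> \<and> (0 = (0::nat) \<longrightarrow> \<Delta> = \<Gamma>)" using assms by (auto simp: ok_def)
    show "\<exists>\<Delta>'. (ok \<Delta>' \<and> (Suc n = 0 \<longrightarrow> \<Delta>' = \<Gamma>)) \<and> step (from_nat n) \<Delta> \<Delta>'"
      if "ok \<Delta> \<and> (n = 0 \<longrightarrow> \<Delta> = \<Gamma>)" for \<Delta> n
      using consistent_step[of \<Delta> "from_nat n"] that by (auto simp: ok_def step_def)
  qed
  then obtain f where f: "f 0 = \<Gamma>" "\<And>n. ok (f n)" "\<And>n. step (from_nat n) (f n) (f (Suc n))"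
    by blast
  have mono: "mono f" using f(3) by (intro mono_iff_le_Suc[THEN iffD2]) (auto simp: step_def)
  define S where "S = (\<Union>n. f n)"
  have sub: "f n \<subseteq> S" for n by (auto simp: S_def)
  have in_f: "step \<phi> (f (to_nat \<phi>)) (f (Suc (to_nat \<phi>)))" for \<phi>
    using f(3)[of "to_nat \<phi>"] by simp
  have "consistent S"
  proof (unfold consistent_def, rule notI)
    assume "S \<turnstile> Fls"
    then obtain \<Delta> where D: "finite \<Delta>" "\<Delta> \<subseteq> S" "\<Delta> \<turnstile> Fls" using prv_finite by blast
    have "\<exists>n. \<Delta> \<subseteq> f n" using D(1,2)
    proof (induction \<Delta> rule: finite_induct)
      case (insert \<phi> \<Delta>)
      then obtain n k where "\<Delta> \<subseteq> f n" "\<phi> \<in> f k" unfolding S_def by auto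
      then have "insert \<phi> \<Delta> \<subseteq> f (max n k)"
        using monoD[OF mono, of n "max n k"] monoD[OF mono, of k "max n k"] by auto
      then show ?case ..
    qed simp
    then obtain n where "\<Delta> \<subseteq> f n" ..
    then show False using D(3) f(2)[of n] prv_weaken unfolding ok_def consistent_def by blast
  qed
  moreover have "\<phi> \<in> S \<or> Neg \<phi> \<in> S" for \<phi> using in_f[of \<phi>] sub unfolding step_def by blast
  moreover have "Forall \<psi> \<in> S \<or> (\<exists>k. Neg (inst (Var k) \<psi>) \<in> S)" for \<psi>
    using in_f[of "Forall \<psi>"] sub unfolding step_def by blast
  ultimately show ?thesis using sub[of 0] f(1) unfolding henkin_def by blast
qed

lemma henkin_closed: "henkin S \<Longrightarrow> S \<turnstile> \<phi> \<Longrightarrow> \<phi> \<in> S"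
  unfolding henkin_def consistent_def by (meson prv.Assm prv_NegE)

lemma henkin_prv_iff: "henkin S \<Longrightarrow> \<phi> \<in> S \<longleftrightarrow> S \<turnstile> \<phi>"
  using henkin_closed prv.Assm by blast

lemma henkin_Fls: "henkin S \<Longrightarrow> Fls \<notin> S"
  unfolding henkin_def consistent_def using prv.Assm by blast

lemma henkin_Neg: "henkin S \<Longrightarrow> Neg \<phi> \<in> S \<longleftrightarrow> \<phi> \<notin> S"
  unfolding henkin_def consistent_def using prv.Assm prv_NegE by blast

lemma henkin_Imp:
  assumes "henkin S" shows "(\<phi> \<^bold>\<longrightarrow> \<psi>) \<in> S \<longleftrightarrow> (\<phi> \<in> S \<longrightarrow> \<psi> \<in> S)"
proof
  assume "(\<phi> \<^bold>\<longrightarrow> \<psi>) \<in> S"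
  then show "\<phi> \<in> S \<longrightarrow> \<psi> \<in> S" using assms henkin_prv_iff prv.ImpE by blast
next
  assume "\<phi> \<in> S \<longrightarrow> \<psi> \<in> S"
  then consider "Neg \<phi> \<in> S" | "\<psi> \<in> S" using henkin_Neg assms by blast
  then show "(\<phi> \<^bold>\<longrightarrow> \<psi>) \<in> S"
  proof cases
    case 1
    then have "insert \<phi> S \<turnstile> Fls" by (intro prv_NegE[OF prv.Assm prv.Assm, of \<phi>]) auto
    then have "insert (Neg \<psi>) (insert \<phi> S) \<turnstile> Fls" by (rule prv_weaken) blast
    then have "insert \<phi> S \<turnstile> \<psi>" by (rule prv.Raa)
    then show ?thesis using assms henkin_closed prv.ImpI by blast
  next
    case 2
    then have "insert \<phi> S \<turnstile> \<psi>" by (simp add: prv.Assm)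
    then show ?thesis using assms henkin_closed prv.ImpI by blast
  qed
qed

lemma henkin_Forall:
  assumes "henkin S" shows "Forall \<psi> \<in> S \<longleftrightarrow> (\<forall>t. inst t \<psi> \<in> S)"
proof
  show "\<forall>t. inst t \<psi> \<in> S" if "Forall \<psi> \<in> S"
    using that assms henkin_prv_iff prv.ForallE by blast
  show "Forall \<psi> \<in> S" if "\<forall>t. inst t \<psi> \<in> S"
    using that assms henkin_Neg[OF assms] unfolding henkin_def by blast
qed

text \<open>\<open>\<phi>\<close> is a context with its hole at index 0; in the applications a term
  that has to stay fixed is written \<open>shift 1 s\<close>.\<close>

lemma henkin_Eq_subst:
  assumes "henkin S" "(s \<^bold>= t) \<in> S" "subst (case_nat s Var) \<phi> \<in> S"
  shows "subst (case_nat t Var) \<phi> \<in> S"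
  using assms henkin_prv_iff[OF assms(1)] prv.EqSubst[of S s t \<phi>] unfolding inst_def by blast

lemma henkin_Eq_refl: "henkin S \<Longrightarrow> (t \<^bold>= t) \<in> S"
  using henkin_closed prv.EqRefl by blast

lemma henkin_Eq_sym:
  assumes "henkin S" "(s \<^bold>= t) \<in> S" shows "(t \<^bold>= s) \<in> S"
  using henkin_Eq_subst[OF assms, of "Var 0 \<^bold>= shift 1 s"] henkin_Eq_refl[OF assms(1)]
  by (simp del: One_nat_def)

lemma henkin_Eq_trans:
  assumes "henkin S" "(s \<^bold>= t) \<in> S" "(t \<^bold>= u) \<in> S" shows "(s \<^bold>= u) \<in> S"
  using henkin_Eq_subst[OF assms(1,3), of "shift 1 s \<^bold>= Var 0"] assms(2)
  by (simp del: One_nat_def)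

lemma henkin_Eq_Succ:
  assumes "henkin S" "(s \<^bold>= t) \<in> S" shows "(Succ s \<^bold>= Succ t) \<in> S"
  using henkin_Eq_subst[OF assms, of "Succ (shift 1 s) \<^bold>= Succ (Var 0)"] henkin_Eq_refl[OF assms(1)]
  by (simp del: One_nat_def)

lemma henkin_Eq_binary:
  assumes "henkin S" "(s \<^bold>= t) \<in> S" "(s' \<^bold>= t') \<in> S"
  shows "(s \<^bold>+ s' \<^bold>= t \<^bold>+ t') \<in> S" "(s \<^bold>* s' \<^bold>= t \<^bold>* t') \<in> S" "(s \<^bold>< s') \<in> S \<Longrightarrow> (t \<^bold>< t') \<in> S"
proof -
  note s = henkin_Eq_subst[OF assms(1,2)] henkin_Eq_subst[OF assms(1,3)]
  show "(s \<^bold>+ s' \<^bold>= t \<^bold>+ t') \<in> S"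
    using s(1)[of "shift 1 s \<^bold>+ shift 1 s' \<^bold>= Var 0 \<^bold>+ shift 1 s'"]
      s(2)[of "shift 1 s \<^bold>+ shift 1 s' \<^bold>= shift 1 t \<^bold>+ Var 0"] henkin_Eq_refl[OF assms(1)]
    by (simp del: One_nat_def)
  show "(s \<^bold>* s' \<^bold>= t \<^bold>* t') \<in> S"
    using s(1)[of "shift 1 s \<^bold>* shift 1 s' \<^bold>= Var 0 \<^bold>* shift 1 s'"]
      s(2)[of "shift 1 s \<^bold>* shift 1 s' \<^bold>= shift 1 t \<^bold>* Var 0"] henkin_Eq_refl[OF assms(1)]
    by (simp del: One_nat_def)
  show "(s \<^bold>< s') \<in> S \<Longrightarrow> (t \<^bold>< t') \<in> S"
    using s(1)[of "Var 0 \<^bold>< shift 1 s'"] s(2)[of "shift 1 t \<^bold>< Var 0"]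
    by (simp del: One_nat_def)
qed

section \<open>Structures, satisfaction and the term model\<close>

datatype 'a struc = Struc (zer: 'a) (suc: "'a \<Rightarrow> 'a") (add: "'a \<Rightarrow> 'a \<Rightarrow> 'a") (mul: "'a \<Rightarrow> 'a \<Rightarrow> 'a")
  (les: "'a \<Rightarrow> 'a \<Rightarrow> bool")

primrec eval :: "'a struc \<Rightarrow> (nat \<Rightarrow> 'a) \<Rightarrow> tm \<Rightarrow> 'a" where
  "eval M v (Var i) = v i"
| "eval M v Zero = zer M"
| "eval M v (Succ t) = suc M (eval M v t)"
| "eval M v (s \<^bold>+ t) = add M (eval M v s) (eval M v t)"
| "eval M v (s \<^bold>* t) = mul M (eval M v s) (eval M v t)"

primrec sat :: "'a struc \<Rightarrow> (nat \<Rightarrow> 'a) \<Rightarrow> fm \<Rightarrow> bool" where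
  "sat M v Fls \<longleftrightarrow> False"
| "sat M v (s \<^bold>= t) \<longleftrightarrow> eval M v s = eval M v t"
| "sat M v (s \<^bold>< t) \<longleftrightarrow> les M (eval M v s) (eval M v t)"
| "sat M v (\<phi> \<^bold>\<longrightarrow> \<psi>) \<longleftrightarrow> (sat M v \<phi> \<longrightarrow> sat M v \<psi>)"
| "sat M v (Forall \<phi>) \<longleftrightarrow> (\<forall>x. sat M (case_nat x v) \<phi>)"

lemma sat_connectives [simp]:
  "sat M v (Neg \<phi>) \<longleftrightarrow> \<not> sat M v \<phi>"
  "sat M v (\<phi> \<^bold>\<and> \<psi>) \<longleftrightarrow> sat M v \<phi> \<and> sat M v \<psi>"
  "sat M v (\<phi> \<^bold>\<or> \<psi>) \<longleftrightarrow> sat M v \<phi> \<or> sat M v \<psi>"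
  "sat M v (\<phi> \<^bold>\<longleftrightarrow> \<psi>) \<longleftrightarrow> (sat M v \<phi> \<longleftrightarrow> sat M v \<psi>)"
  "sat M v (Exists \<phi>) \<longleftrightarrow> (\<exists>x. sat M (case_nat x v) \<phi>)"
  by (auto simp: Neg_def Con_def Dis_def Iff_def Exists_def)

lemma eval_subst_tm: "eval M v (subst_tm \<sigma> t) = eval M (\<lambda>i. eval M v (\<sigma> i)) t"
  by (induction t) auto

lemma eval_shift [simp]: "eval M v (shift k t) = eval M (\<lambda>i. v (i + k)) t"
  by (simp add: shift_def eval_subst_tm)

lemma sat_subst: "sat M v (subst \<sigma> \<phi>) \<longleftrightarrow> sat M (\<lambda>i. eval M v (\<sigma> i)) \<phi>"
proof (induction \<phi> arbitrary: v \<sigma>)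
  case (Forall \<phi>)
  have "(\<lambda>i. eval M (case_nat x v) (lift \<sigma> i)) = case_nat x (\<lambda>i. eval M v (\<sigma> i))" for x
    by (auto split: nat.split simp: lift_def)
  then show ?case by (simp add: subst_Forall Forall del: subst.simps)
qed (auto simp: eval_subst_tm)

lemma eval_cong: "(\<And>i. i < bound_tm t \<Longrightarrow> v i = w i) \<Longrightarrow> eval M v t = eval M w t"
  by (induction t) auto

lemma sat_cong: "(\<And>i. i < bound \<phi> \<Longrightarrow> v i = w i) \<Longrightarrow> sat M v \<phi> \<longleftrightarrow> sat M w \<phi>"
proof (induction \<phi> arbitrary: v w)
  case (Forall \<phi>)
  have "sat M (case_nat x v) \<phi> \<longleftrightarrow> sat M (case_nat x w) \<phi>" for x
    using Forall.prems by (intro Forall.IH) (auto split: nat.split)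
  then show ?case by simp
next
  case (Eq s t)
  then have "eval M v s = eval M w s" "eval M v t = eval M w t" by (auto intro: eval_cong)
  then show ?case by simp
next
  case (Lt s t)
  then have "eval M v s = eval M w s" "eval M v t = eval M w t" by (auto intro: eval_cong)
  then show ?case by simp
next
  case (Imp \<phi> \<psi>)
  have "sat M v \<phi> = sat M w \<phi>" by (rule Imp.IH(1)) (simp add: Imp.prems)
  moreover have "sat M v \<psi> = sat M w \<psi>" by (rule Imp.IH(2)) (simp add: Imp.prems)
  ultimately show ?case by simp
qed simp

text \<open>The term model is carried over to a given countably infinite type: \<open>h t\<close> stands for the class of
  the term \<open>t\<close>.\<close>

lemma henkin_model:
  assumes S: "henkin S"
    and inf: "infinite {{s. (s \<^bold>= t) \<in> S} |t. True}"
    and infA: "infinite (UNIV :: 'a::countable set)"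
  shows "\<exists>(M :: 'a struc) v. \<forall>\<phi>. sat M v \<phi> \<longleftrightarrow> \<phi> \<in> S"
proof -
  define cl where "cl t = {s. (s \<^bold>= t) \<in> S}" for t
  have cl: "cl s = cl t \<longleftrightarrow> (s \<^bold>= t) \<in> S" for s t
    using henkin_Eq_refl[OF S] henkin_Eq_sym[OF S] henkin_Eq_trans[OF S]
    unfolding cl_def by blast
  have "infinite (range cl)" using inf by (simp add: cl_def full_SetCompr_eq)
  then have b1: "bij_betw (to_nat_on (range cl)) (range cl) UNIV"
    by (intro to_nat_on_infinite) auto
  have b2: "bij_betw (from_nat_into (UNIV :: 'a set)) UNIV UNIV"
    using infA by (intro bij_betw_from_nat_into) auto
  \<comment> \<open>Composed of two bijections through the natural numbers: equal values mean equal
    classes, and every element of the type is reached.\<close>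
  define h where "h t = from_nat_into (UNIV :: 'a set) (to_nat_on (range cl) (cl t))" for t
  have h_eq: "h s = h t \<longleftrightarrow> (s \<^bold>= t) \<in> S" for s t
    unfolding h_def cl[symmetric]
    using b1 b2 by (metis bij_betw_def inj_on_eq_iff UNIV_I rangeI)
  have h_surj: "\<exists>t. h t = x" for x
  proof -
    obtain n where "from_nat_into (UNIV :: 'a set) n = x" using b2 by (metis bij_pointE)
    moreover obtain t where "to_nat_on (range cl) (cl t) = n" using b1
      by (metis (no_types, lifting) UNIV_I bij_betw_imp_surj_on imageE)
    ultimately show ?thesis unfolding h_def by blast
  qed
  define g where "g x = (SOME t. h t = x)" for x
  have hg: "h (g x) = x" for x unfolding g_def using h_surj by (rule someI_ex)
  have gh: "(g (h t) \<^bold>= t) \<in> S" for t using hg[of "h t"] h_eq by blast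
  \<comment> \<open>The operations act on chosen representatives; congruence of equality in
    \<open>S\<close> makes the choice immaterial.\<close>
  define M where "M = Struc (h Zero) (\<lambda>x. h (Succ (g x))) (\<lambda>x y. h (g x \<^bold>+ g y))
    (\<lambda>x y. h (g x \<^bold>* g y)) (\<lambda>x y. (g x \<^bold>< g y) \<in> S)"
  have ev: "eval M (\<lambda>i. h (\<sigma> i)) t = h (subst_tm \<sigma> t)" for \<sigma> t
  proof (induction t)
    case (Succ t) then show ?case using gh henkin_Eq_Succ[OF S] by (simp add: M_def h_eq)
  next
    case (Add t1 t2) then show ?case using gh henkin_Eq_binary[OF S] by (simp add: M_def h_eq)
  next
    case (Mul t1 t2) then show ?case using gh henkin_Eq_binary[OF S] by (simp add: M_def h_eq)
  qed (auto simp: M_def)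
  \<comment> \<open>Proved for all substitutions at once: under a quantifier the valuation gains a
    value \<open>h t\<close>, that is, the substitution gains the term \<open>t\<close>.\<close>
  have "sat M (\<lambda>i. h (\<sigma> i)) \<phi> \<longleftrightarrow> subst \<sigma> \<phi> \<in> S" for \<sigma> \<phi>
  proof (induction \<phi> arbitrary: \<sigma>)
    case Fls then show ?case using henkin_Fls[OF S] by simp
  next
    case (Eq s t) then show ?case by (simp add: ev h_eq)
  next
    case (Lt s t)
    have "les M (h s') (h t') \<longleftrightarrow> (s' \<^bold>< t') \<in> S" for s' t'
      using henkin_Eq_binary(3)[OF S] gh henkin_Eq_sym[OF S] by (simp add: M_def) blast
    then show ?case by (simp add: ev)
  next
    case (Imp \<phi> \<psi>) then show ?case by (simp add: henkin_Imp[OF S])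
  next
    case (Forall \<phi>)
    have "sat M (\<lambda>i. h (\<sigma> i)) (Forall \<phi>) \<longleftrightarrow> (\<forall>t. sat M (case_nat (h t) (\<lambda>i. h (\<sigma> i))) \<phi>)"
      using h_surj by (metis sat.simps(5))
    also have "\<dots> \<longleftrightarrow> (\<forall>t. sat M (\<lambda>i. h (case_nat t \<sigma> i)) \<phi>)"
    proof -
      have "case_nat (h t) (\<lambda>i. h (\<sigma> i)) = (\<lambda>i. h (case_nat t \<sigma> i))" for t
        by (auto split: nat.split)
      then show ?thesis by simp
    qed
    also have "\<dots> \<longleftrightarrow> subst \<sigma> (Forall \<phi>) \<in> S"
      by (simp only: Forall subst_Forall henkin_Forall[OF S] inst_subst_lift)
    finally show ?case .
  qed
  from this[of Var] show ?thesis by auto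
qed

text \<open>The infinite set of terms \<open>T\<close> guarantees that all models are infinite.\<close>

theorem completeness:
  assumes sentences: "\<And>\<phi>. \<phi> \<in> \<Gamma> \<Longrightarrow> bound \<phi> = 0"
    and T: "infinite T" "\<And>s t. s \<in> T \<Longrightarrow> t \<in> T \<Longrightarrow> s \<noteq> t \<Longrightarrow> \<Gamma> \<turnstile> Neg (s \<^bold>= t)"
    and infA: "infinite (UNIV :: 'a::countable set)"
    and valid: "\<And>(M :: 'a struc) v. (\<And>\<phi>. \<phi> \<in> \<Gamma> \<Longrightarrow> sat M v \<phi>) \<Longrightarrow> sat M v \<psi>"
  shows "\<Gamma> \<turnstile> \<psi>"
proof (rule ccontr)
  assume "\<not> \<Gamma> \<turnstile> \<psi>"
  then have "consistent (insert (Neg \<psi>) \<Gamma>)" unfolding consistent_def using prv.Raa by blast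
  moreover have "bounded_vars (insert (Neg \<psi>) \<Gamma>)"
    using sentences by (intro bounded_vars_insert) (auto simp: bounded_vars_def)
  ultimately obtain S where S: "insert (Neg \<psi>) \<Gamma> \<subseteq> S" "henkin S" using henkin_extension by blast
  \<comment> \<open>Provably different terms lie in different classes, so the term model is
    infinite, as \<open>henkin_model\<close> requires.\<close>
  have "inj_on (\<lambda>t. {s. (s \<^bold>= t) \<in> S}) T"
  proof (rule inj_onI, rule ccontr)
    fix s t assume st: "s \<in> T" "t \<in> T" "{u. (u \<^bold>= s) \<in> S} = {u. (u \<^bold>= t) \<in> S}" "s \<noteq> t"
    then have "(s \<^bold>= t) \<in> S" using henkin_Eq_refl[OF S(2), of s] by blast
    moreover have "Neg (s \<^bold>= t) \<in> S"
      using S(1) by (intro henkin_closed[OF S(2)] prv_weaken[OF T(2)[OF st(1,2,4)]]) simp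
    ultimately show False using henkin_Neg[OF S(2)] by blast
  qed
  then have "infinite ((\<lambda>t. {s. (s \<^bold>= t) \<in> S}) ` T)" using T(1) finite_imageD by blast
  then have "infinite {{s. (s \<^bold>= t) \<in> S} |t. True}"
    by (rule contrapos_nn) (erule rev_finite_subset, auto)
  from henkin_model[OF S(2) this infA] obtain M :: "'a struc" and v
    where M: "\<And>\<phi>. sat M v \<phi> \<longleftrightarrow> \<phi> \<in> S" by blast
  then have "sat M v \<psi>" using S(1) by (intro valid) auto
  then show False using M S henkin_Neg by blast
qed

section \<open>Models of EFA\<close>

lemma bound_funpow_Forall: "bound ((Forall ^^ n) \<phi>) = bound \<phi> - n"
  by (induction n) auto

lemma bound_EFA: "\<phi> \<in> EFA \<Longrightarrow> bound \<phi> = 0"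
  by (auto simp: EFA_def ISigma0_def closure_def bound_funpow_Forall Exp_def Pow2_def Beta_def
      BEx_def BAll_def Exists_def Con_def Neg_def shift_def)

lemma sat_funpow_Forall:
  "sat M v ((Forall ^^ n) \<phi>) \<Longrightarrow> sat M (\<lambda>i. if i < n then w i else v (i - n)) \<phi>"
proof (induction n arbitrary: v)
  case (Suc n)
  \<comment> \<open>The outermost quantifier binds the largest index, \<open>n\<close>, of the
    body.\<close>
  then have "sat M (case_nat (w n) v) ((Forall ^^ n) \<phi>)" by simp
  from Suc.IH[OF this] show ?case
    by (rule back_subst[of "\<lambda>e. sat M e \<phi>"])
      (auto simp: fun_eq_iff less_Suc_eq not_less_eq Suc_diff_Suc split: nat.split dest: diff_is_0_eq[THEN iffD1] intro!: arg_cong[of _ _ v])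
qed simp

lemma sat_closure:
  assumes "sat M v (closure \<phi>)" shows "sat M w \<phi>"
  using sat_funpow_Forall[OF assms[unfolded closure_def], of w]
  by (subst sat_cong[of \<phi> w]) auto

definition model :: "'a struc \<Rightarrow> bool" where
  "model M \<longleftrightarrow> (\<forall>\<phi>\<in>EFA. \<forall>v. sat M v \<phi>)"

lemma prv_ForallE2: "\<Gamma> \<turnstile> Forall (Forall \<phi>) \<Longrightarrow> \<Gamma> \<turnstile> subst (case_nat t (case_nat s Var)) \<phi>"
  unfolding inst_subst_lift[symmetric]
  by (intro prv.ForallE) (use prv.ForallE[of \<Gamma> _ s] in \<open>force simp: inst_def lift_def\<close>)

lemma EFA_Succ_inj: "EFA \<turnstile> Succ s \<^bold>= Succ t \<^bold>\<longrightarrow> s \<^bold>= t"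
proof -
  let ?\<phi> = "Succ (Var 0) \<^bold>= Succ (Var 1) \<^bold>\<longrightarrow> Var 0 \<^bold>= Var 1"
  have "EFA \<turnstile> closure ?\<phi>" by (intro prv.Assm) (auto simp: EFA_def ISigma0_def Robinson_def)
  moreover have "closure ?\<phi> = Forall (Forall ?\<phi>)" by (simp add: closure_def numeral_2_eq_2)
  ultimately show ?thesis using prv_ForallE2[of EFA ?\<phi> s t] by simp
qed

lemma EFA_Succ_nonzero: "EFA \<turnstile> Neg (Succ t \<^bold>= Zero)"
proof -
  let ?\<phi> = "Neg (Succ (Var 0) \<^bold>= Zero)"
  have "EFA \<turnstile> closure ?\<phi>" by (intro prv.Assm) (auto simp: EFA_def ISigma0_def Robinson_def)
  moreover have "closure ?\<phi> = Forall ?\<phi>" by (simp add: closure_def Neg_def)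
  ultimately show ?thesis using prv.ForallE[of EFA ?\<phi> t] by (simp add: inst_def)
qed

lemma prv_Eq_sym: "\<Gamma> \<turnstile> s \<^bold>= t \<Longrightarrow> \<Gamma> \<turnstile> t \<^bold>= s"
  using prv.EqSubst[of \<Gamma> s t "Var 0 \<^bold>= shift 1 s"] prv.EqRefl[of \<Gamma> s] by (simp add: inst_def del: One_nat_def)

text \<open>Successors are peeled off both sides until one numeral is zero. The numerals thus supply
  the infinite set of terms for \<open>completeness\<close>.\<close>

lemma numerals_distinct:
  assumes "EFA \<subseteq> \<Gamma>" "i \<noteq> j" "\<Gamma> \<turnstile> (Succ ^^ i) Zero \<^bold>= (Succ ^^ j) Zero"
  shows "\<Gamma> \<turnstile> Fls"
  using assms(2,3)
proof (induction i arbitrary: j)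
  case 0
  obtain k where "j = Suc k" using 0(1) by (cases j) auto
  with 0(2) have "\<Gamma> \<turnstile> Zero \<^bold>= Succ ((Succ ^^ k) Zero)" by simp
  then have "\<Gamma> \<turnstile> Succ ((Succ ^^ k) Zero) \<^bold>= Zero" by (rule prv_Eq_sym)
  then show ?case by (rule prv_NegE[OF prv_weaken[OF EFA_Succ_nonzero assms(1)]])
next
  case (Suc i)
  show ?case
  proof (cases j)
    case 0
    with Suc.prems have "\<Gamma> \<turnstile> Succ ((Succ ^^ i) Zero) \<^bold>= Zero" by simp
    then show ?thesis by (rule prv_NegE[OF prv_weaken[OF EFA_Succ_nonzero assms(1)]])
  next
    case (Suc k)
    with Suc.prems have "\<Gamma> \<turnstile> Succ ((Succ ^^ i) Zero) \<^bold>= Succ ((Succ ^^ k) Zero)" by simp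
    then have "\<Gamma> \<turnstile> (Succ ^^ i) Zero \<^bold>= (Succ ^^ k) Zero"
      by (rule prv.ImpE[OF prv_weaken[OF EFA_Succ_inj assms(1)]])
    then show ?thesis using Suc.IH[of k] Suc Suc.prems by simp
  qed
qed

datatype elem = Elem (idx: nat)

instance elem :: countable by countable_datatype

lemma infinite_elem: "infinite (UNIV :: elem set)"
proof
  assume "finite (UNIV :: elem set)"
  then have "finite (range Elem)" by (rule rev_finite_subset) simp
  then show False using finite_imageD[of Elem UNIV] by (auto simp: inj_on_def)
qed

lemma EFA_complete:
  assumes "\<And>(M :: elem struc) v. model M \<Longrightarrow> sat M v \<psi>"
  shows "EFA \<turnstile> \<psi>"
proof (rule completeness[where T = "range (\<lambda>i. (Succ ^^ i) Zero)", OF bound_EFA _ _ infinite_elem])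
  have "i = j" if "(Succ ^^ i) Zero = (Succ ^^ j) Zero" for i j
    using that
  proof (induction i arbitrary: j)
    case 0 then show ?case by (cases j) auto
  next
    case (Suc i) then show ?case by (cases j) auto
  qed
  then show "infinite (range (\<lambda>i. (Succ ^^ i) Zero))"
    by (intro range_inj_infinite) (auto simp: inj_def)
  show "EFA \<turnstile> Neg (s \<^bold>= t)"
    if "s \<in> range (\<lambda>i. (Succ ^^ i) Zero)" "t \<in> range (\<lambda>i. (Succ ^^ i) Zero)" "s \<noteq> t" for s t
  proof -
    from that(1,2) obtain i j where "s = (Succ ^^ i) Zero" "t = (Succ ^^ j) Zero" by auto
    then have ij: "s = (Succ ^^ i) Zero" "t = (Succ ^^ j) Zero" "i \<noteq> j" using that(3) by auto
    have "insert (s \<^bold>= t) EFA \<turnstile> s \<^bold>= t" by (simp add: prv.Assm)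
    then show ?thesis using ij by (intro prv_NegI numerals_distinct[of _ i j]) auto
  qed
  show "sat M v \<psi>" if "\<And>\<phi>. \<phi> \<in> EFA \<Longrightarrow> sat M v \<phi>" for M :: "elem struc" and v
  proof (rule assms)
    show "model M" unfolding model_def using that sat_cong[of _ _ v M] bound_EFA
      by (metis less_nat_zero_code)
  qed
qed

section \<open>Bounded definability\<close>

text \<open>The first \<open>k\<close> variables are the arguments; the remaining ones enumerate all elements of the
  model, so that every element may be used as a parameter.\<close>

definition env :: "nat \<Rightarrow> (nat \<Rightarrow> elem) \<Rightarrow> nat \<Rightarrow> elem" where
  "env k v i = (if i < k then v i else Elem (i - k))"

text \<open>With definability taken semantically, concrete predicates are shown definable by closure
  rules, without writing out formulas.\<close>

definition deft :: "elem struc \<Rightarrow> nat \<Rightarrow> ((nat \<Rightarrow> elem) \<Rightarrow> elem) \<Rightarrow> bool" where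
  "deft M k f \<longleftrightarrow> (\<exists>t. \<forall>v. eval M (env k v) t = f v)"

definition defb :: "elem struc \<Rightarrow> nat \<Rightarrow> ((nat \<Rightarrow> elem) \<Rightarrow> bool) \<Rightarrow> bool" where
  "defb M k A \<longleftrightarrow> (\<exists>\<phi>. Sigma0 \<phi> \<and> (\<forall>v. sat M (env k v) \<phi> \<longleftrightarrow> A v))"

lemma deft_var: "i < k \<Longrightarrow> deft M k (\<lambda>v. v i)"
  unfolding deft_def by (rule exI[of _ "Var i"]) (simp add: env_def)

text \<open>The enumeration of parameters pays off here: \<open>c\<close> is the value of the
  variable at position \<open>k + idx c\<close>.\<close>

lemma deft_const: "deft M k (\<lambda>v. c)"
  unfolding deft_def by (rule exI[of _ "Var (k + idx c)"]) (simp add: env_def)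

lemma deft_suc: "deft M k f \<Longrightarrow> deft M k (\<lambda>v. suc M (f v))"
  unfolding deft_def by (metis eval.simps(3))

lemma deft_add: "deft M k f \<Longrightarrow> deft M k g \<Longrightarrow> deft M k (\<lambda>v. add M (f v) (g v))"
  unfolding deft_def by (metis eval.simps(4))

lemma deft_mul: "deft M k f \<Longrightarrow> deft M k g \<Longrightarrow> deft M k (\<lambda>v. mul M (f v) (g v))"
  unfolding deft_def by (metis eval.simps(5))

lemma defb_eq: "deft M k f \<Longrightarrow> deft M k g \<Longrightarrow> defb M k (\<lambda>v. f v = g v)"
  unfolding deft_def defb_def by (metis sat.simps(2) Sigma0.intros(2))

lemma defb_les: "deft M k f \<Longrightarrow> deft M k g \<Longrightarrow> defb M k (\<lambda>v. les M (f v) (g v))"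
  unfolding deft_def defb_def by (metis sat.simps(3) Sigma0.intros(3))

lemma defb_False: "defb M k (\<lambda>v. False)"
  unfolding defb_def by (rule exI[of _ Fls]) (simp add: Sigma0.intros)

lemma defb_imp: "defb M k A \<Longrightarrow> defb M k B \<Longrightarrow> defb M k (\<lambda>v. A v \<longrightarrow> B v)"
  unfolding defb_def by (metis sat.simps(4) Sigma0.intros(4))

lemma defb_not: "defb M k A \<Longrightarrow> defb M k (\<lambda>v. \<not> A v)"
  using defb_imp[OF _ defb_False] by simp

lemma defb_const: "defb M k (\<lambda>v. P)"
  using defb_not[OF defb_False] defb_False by (cases P) auto

lemma defb_or: "defb M k A \<Longrightarrow> defb M k B \<Longrightarrow> defb M k (\<lambda>v. A v \<or> B v)"
  using defb_imp[OF defb_not, of M k A B] by (simp add: disj_imp)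

lemma defb_and: "defb M k A \<Longrightarrow> defb M k B \<Longrightarrow> defb M k (\<lambda>v. A v \<and> B v)"
  using defb_not[OF defb_imp[OF _ defb_not], of M k A B] by simp

lemma defb_iff: "defb M k A \<Longrightarrow> defb M k B \<Longrightarrow> defb M k (\<lambda>v. A v \<longleftrightarrow> B v)"
  using defb_and[OF defb_imp defb_imp, of M k A B B A] by (simp add: iff_conv_conj_imp)

lemma defb_all:
  assumes "deft M k t" "defb M (Suc k) (\<lambda>v. A (\<lambda>i. v (Suc i)) (v 0))"
  shows "defb M k (\<lambda>v. \<forall>x. les M x (t v) \<longrightarrow> A v x)"
proof -
  obtain s where s: "\<And>v. eval M (env k v) s = t v" using assms(1) unfolding deft_def by blast
  obtain \<phi> where \<phi>: "Sigma0 \<phi>" "\<And>v. sat M (env (Suc k) v) \<phi> \<longleftrightarrow> A (\<lambda>i. v (Suc i)) (v 0)"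
    using assms(2) unfolding defb_def by blast
  \<comment> \<open>The bound variable takes position 0; the parameters move up by one and still
    start right after the arguments.\<close>
  have "case_nat x (env k v) = env (Suc k) (case_nat x v)" for x v
    by (auto simp: env_def fun_eq_iff split: nat.split)
  moreover have "sat M (env k v) (BAll s \<phi>) \<longleftrightarrow> (\<forall>x. les M x (t v) \<longrightarrow> sat M (case_nat x (env k v)) \<phi>)" for v
    by (simp add: BAll_def s)
  ultimately have "sat M (env k v) (BAll s \<phi>) \<longleftrightarrow> (\<forall>x. les M x (t v) \<longrightarrow> A v x)" for v
    by (simp add: \<phi>(2))
  then show ?thesis unfolding defb_def using Sigma0.intros(5)[OF \<phi>(1)] by blast
qed

lemma defb_ex:
  assumes "deft M k t" "defb M (Suc k) (\<lambda>v. A (\<lambda>i. v (Suc i)) (v 0))"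
  shows "defb M k (\<lambda>v. \<exists>x. les M x (t v) \<and> A v x)"
  using defb_not[OF defb_all[of M k t "\<lambda>v x. \<not> A v x", OF assms(1) defb_not[OF assms(2)]]] by simp

locale efa_model =
  fixes M :: "elem struc"
  assumes mod: "model M"
begin

lemma robinson: "\<phi> \<in> Robinson \<Longrightarrow> sat M v \<phi>"
  using mod sat_closure[of M _ \<phi> v] unfolding model_def EFA_def ISigma0_def by blast

lemma induct:
  assumes "defb M 1 (\<lambda>v. A (v 0))" "A (zer M)" "\<And>x. A x \<Longrightarrow> A (suc M x)"
  shows "A x"
proof -
  obtain \<phi> where \<phi>: "Sigma0 \<phi>" "\<And>v. sat M (env 1 v) \<phi> \<longleftrightarrow> A (v 0)"
    using assms(1) unfolding defb_def by blast
  have A: "sat M (case_nat y Elem) \<phi> \<longleftrightarrow> A y" for y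
  proof -
    have "env 1 (\<lambda>_. y) = case_nat y Elem" by (auto simp: env_def fun_eq_iff split: nat.split)
    then show ?thesis using \<phi>(2)[of "\<lambda>_. y"] by simp
  qed
  \<comment> \<open>Outside the quantifier the parameters start at index 0, so the valuation
    \<open>Elem\<close> gives them the values prescribed by \<open>env 1\<close>.\<close>
  have "sat M Elem (Induction \<phi>)"
    using mod sat_closure[of M _ "Induction \<phi>"] \<phi>(1) unfolding model_def EFA_def ISigma0_def by blast
  moreover have "(\<lambda>i. eval M Elem (case_nat Zero Var i)) = case_nat (zer M) Elem"
    by (auto split: nat.split)
  moreover have "(\<lambda>i. eval M (case_nat y Elem) (case_nat (Succ (Var 0)) (\<lambda>i. Var (Suc i)) i))
      = case_nat (suc M y) Elem" for y
    by (auto split: nat.split)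
  ultimately show ?thesis using assms(2,3) by (simp add: Induction_def inst_def sat_subst A)
qed

abbreviation "Z \<equiv> zer M"
abbreviation "S \<equiv> suc M"

abbreviation plus' (infixl "+." 65) where "x +. y \<equiv> add M x y"
abbreviation times' (infixl "*." 70) where "x *. y \<equiv> mul M x y"
abbreviation less' (infix "<." 50) where "x <. y \<equiv> les M x y"

section \<open>Laws of order and arithmetic by bounded induction\<close>

lemma suc_nonzero [simp]: "S x \<noteq> Z" "Z \<noteq> S x"
proof -
  show "S x \<noteq> Z" using robinson[of "Neg (Succ (Var 0) \<^bold>= Zero)" "\<lambda>_. x"] by (simp add: Robinson_def)
  then show "Z \<noteq> S x" by metis
qed

lemma suc_inj [simp]: "S x = S y \<longleftrightarrow> x = y"
  using robinson[of "Succ (Var 0) \<^bold>= Succ (Var 1) \<^bold>\<longrightarrow> Var 0 \<^bold>= Var 1" "case_nat x (\<lambda>_. y)"]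
  by (auto simp: Robinson_def)

lemma zero_or_suc: "x = Z \<or> (\<exists>y. x = S y)"
  using robinson[of "Neg (Var 0 \<^bold>= Zero) \<^bold>\<longrightarrow> Exists (Var 1 \<^bold>= Succ (Var 0))" "\<lambda>_. x"]
  by (auto simp: Robinson_def)

lemma add_rec [simp]: "x +. Z = x" "x +. S y = S (x +. y)"
  using robinson[of "Var 0 \<^bold>+ Zero \<^bold>= Var 0" "\<lambda>_. x"]
    robinson[of "Var 0 \<^bold>+ Succ (Var 1) \<^bold>= Succ (Var 0 \<^bold>+ Var 1)" "case_nat x (\<lambda>_. y)"]
  by (auto simp: Robinson_def)

lemma mul_rec [simp]: "x *. Z = Z" "x *. S y = x *. y +. x"
  using robinson[of "Var 0 \<^bold>* Zero \<^bold>= Zero" "\<lambda>_. x"]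
    robinson[of "Var 0 \<^bold>* Succ (Var 1) \<^bold>= Var 0 \<^bold>* Var 1 \<^bold>+ Var 0" "case_nat x (\<lambda>_. y)"]
  by (auto simp: Robinson_def)

lemma les_iff: "x <. y \<longleftrightarrow> (\<exists>z. S z +. x = y)"
  using robinson[of "Var 0 \<^bold>< Var 1 \<^bold>\<longleftrightarrow> Exists (Succ (Var 0) \<^bold>+ Var 1 \<^bold>= Var 2)" "case_nat x (\<lambda>_. y)"]
  by (auto simp: Robinson_def numeral_2_eq_2)

lemmas defs = defb_eq defb_les defb_imp defb_not defb_or defb_and deft_const deft_var deft_suc deft_add deft_mul

lemma add_zero_left [simp]: "Z +. x = x"
  by (rule induct[where A = "\<lambda>x. Z +. x = x"]) (auto intro!: defs)

lemma add_suc_left [simp]: "S x +. y = S (x +. y)"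
  by (rule induct[where A = "\<lambda>y. S x +. y = S (x +. y)"]) (auto intro!: defs)

lemma add_comm: "x +. y = y +. x"
  by (rule induct[where A = "\<lambda>y. x +. y = y +. x"]) (auto intro!: defs)

lemma add_assoc: "x +. y +. z = x +. (y +. z)"
  by (rule induct[where A = "\<lambda>z. x +. y +. z = x +. (y +. z)"]) (auto intro!: defs)

lemma add_left_comm: "y +. (x +. z) = x +. (y +. z)"
  by (metis add_assoc add_comm)

lemma mul_zero_left [simp]: "Z *. x = Z"
  by (rule induct[where A = "\<lambda>x. Z *. x = Z"]) (auto intro!: defs)

lemma mul_suc_left [simp]: "S x *. y = x *. y +. y"
  by (rule induct[where A = "\<lambda>y. S x *. y = x *. y +. y"])
    (auto intro!: defs simp: add_assoc add_comm add_left_comm)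

lemma mul_comm: "x *. y = y *. x"
  by (rule induct[where A = "\<lambda>y. x *. y = y *. x"]) (auto intro!: defs)

lemma mul_distrib: "(x +. y) *. z = x *. z +. y *. z"
  by (rule induct[where A = "\<lambda>z. (x +. y) *. z = x *. z +. y *. z"])
    (auto intro!: defs simp: add_assoc add_comm add_left_comm)

lemma mul_assoc: "x *. y *. z = x *. (y *. z)"
  by (rule induct[where A = "\<lambda>z. x *. y *. z = x *. (y *. z)"])
    (auto intro!: defs simp: mul_distrib mul_comm[of x])

lemma add_cancel: "x +. z = y +. z \<longleftrightarrow> x = y"
  by (rule induct[where A = "\<lambda>z. x +. z = y +. z \<longleftrightarrow> x = y"])
    (auto intro!: defs defb_iff defb_const)

lemma les_trans: "x <. y \<Longrightarrow> y <. z \<Longrightarrow> x <. z"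
  unfolding les_iff by (metis add_assoc add_suc_left)

lemma les_suc: "x <. S x"
  unfolding les_iff by (metis add_suc_left add_zero_left)

lemma les_total: "x <. y \<or> x = y \<or> y <. x"
proof (rule induct[where A = "\<lambda>y. x <. y \<or> x = y \<or> y <. x"])
  show "x <. Z \<or> x = Z \<or> Z <. x"
    using zero_or_suc[of x] unfolding les_iff by (metis add_rec(1))
  show "x <. S y \<or> x = S y \<or> S y <. x" if "x <. y \<or> x = y \<or> y <. x" for y
  proof -
    have "x = S y \<or> S y <. x" if "y <. x"
      using that zero_or_suc unfolding les_iff by (metis add_rec(2) add_suc_left add_zero_left)
    then show ?thesis using that les_suc les_trans by blast
  qed
qed (intro defs, auto)

end

section \<open>The arithmetic of a model\<close>

text \<open>These laws suffice for the class instances below and, unlike \<open>model\<close>, are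
  easily checked for the standard structure.\<close>

locale arith =
  fixes M :: "elem struc"
  assumes laws:
    "add M (add M x y) z = add M x (add M y z)" "add M x y = add M y x" "add M (zer M) x = x"
    "add M x y = add M x z \<Longrightarrow> y = z" "suc M x = add M x (suc M (zer M))"
    "mul M (mul M x y) z = mul M x (mul M y z)" "mul M x y = mul M y x"
    "mul M (suc M (zer M)) x = x" "mul M (zer M) x = zer M"
    "mul M (add M x y) z = add M (mul M x z) (mul M y z)" "suc M x \<noteq> zer M"
    "x = zer M \<or> (\<exists>y. x = suc M y)" "les M x y \<longleftrightarrow> (\<exists>z. y = add M x (suc M z))"
    "les M x y \<or> x = y \<or> les M y x"

lemma (in efa_model) arith: "arith M"
proof
  fix x y z
  show "x +. y +. z = x +. (y +. z)" "x +. y = y +. x" "x *. y *. z = x *. (y *. z)" "x *. y = y *. x"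
    "(x +. y) *. z = x *. z +. y *. z"
    by (rule add_assoc add_comm mul_assoc mul_comm mul_distrib)+
  show "x = Z \<or> (\<exists>y. x = S y)" "x <. y \<or> x = y \<or> y <. x"
    by (rule zero_or_suc les_total)+
  show "x +. y = x +. z \<Longrightarrow> y = z" by (metis add_cancel add_comm)
  show "x <. y \<longleftrightarrow> (\<exists>z. y = x +. S z)" unfolding les_iff by (metis add_comm)
qed auto

text \<open>Class instances cannot carry hypotheses, so \<open>U\<close> must satisfy
  \<open>arith\<close> even if there is no countermodel. In that case this structure shows that the
  choice of \<open>U\<close> is possible.\<close>

definition nat_model :: "elem struc" where
  "nat_model = Struc (Elem 0) (\<lambda>x. Elem (Suc (idx x))) (\<lambda>x y. Elem (idx x + idx y))
    (\<lambda>x y. Elem (idx x * idx y)) (\<lambda>x y. idx x < idx y)"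

lemma arith_nat_model: "arith nat_model"
proof -
  have "idx x < idx y \<longleftrightarrow> (\<exists>z. y = Elem (Suc (idx x + idx z)))" for x y
    by (metis elem.collapse elem.sel less_iff_Suc_add)
  moreover have "x = Elem 0 \<or> (\<exists>y. x = Elem (Suc (idx y)))" for x
    by (metis elem.collapse elem.sel not0_implies_Suc)
  moreover have "idx x < idx y \<or> x = y \<or> idx y < idx x" for x y
    by (metis elem.expand linorder_neqE_nat)
  ultimately show ?thesis
    by unfold_locales (auto simp: nat_model_def algebra_simps intro: elem.expand)
qed

definition BL_sentence :: fm where
  "BL_sentence = Forall (Zero \<^bold>< Var 0 \<^bold>\<longrightarrow> BL (Var 1 \<^bold>* Var 0))"

text \<open>A type cannot depend on an arbitrary model, so the type \<open>elem\<close> is given the structure of one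
  fixed model that refutes the sentence if there is one; otherwise any structure will do.\<close>

definition U :: "elem struc" where
  "U = (SOME M. arith M \<and> ((\<exists>M v. model (M :: elem struc) \<and> \<not> sat M v BL_sentence)
    \<longrightarrow> model M \<and> (\<exists>v. \<not> sat M v BL_sentence)))"

lemma U: "arith U" "(\<exists>M v. model (M :: elem struc) \<and> \<not> sat M v BL_sentence)
    \<longrightarrow> model U \<and> (\<exists>v. \<not> sat U v BL_sentence)"
proof -
  have "\<exists>M. arith M \<and> ((\<exists>M v. model (M :: elem struc) \<and> \<not> sat M v BL_sentence)
    \<longrightarrow> model M \<and> (\<exists>v. \<not> sat M v BL_sentence))"
    using arith_nat_model efa_model.arith efa_model.intro by blast
  from someI_ex[OF this] show "arith U" "(\<exists>M v. model (M :: elem struc) \<and> \<not> sat M v BL_sentence)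
    \<longrightarrow> model U \<and> (\<exists>v. \<not> sat U v BL_sentence)"
    unfolding U_def by blast+
qed

lemmas U_laws = arith.laws[OF U(1)]

section \<open>The type of elements as a linearly ordered semiring\<close>

instantiation elem :: "{zero, one, plus, times, minus, linorder}"
begin
definition "0 = zer U"
definition "1 = suc U (zer U)"
definition "x + y = add U x y"
definition "x * y = mul U x y"
definition "x < y \<longleftrightarrow> les U x y"
definition "x \<le> y \<longleftrightarrow> x = y \<or> les U x y" for x y :: elem
text \<open>Truncated subtraction: the default 0 is what the law
  \<open>x - y - z = x - (y + z)\<close> demands when \<open>y + z\<close> exceeds
  \<open>x\<close>.\<close>

definition "x - y = (if \<exists>z. x = y + z then SOME z. x = y + z else 0)" for x y :: elem

instance
proof
  fix x y z :: elem
  have tr: "les U x y \<Longrightarrow> les U y z \<Longrightarrow> les U x z" for x y z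
    unfolding U_laws(13) by (metis U_laws(1,2,5))
  have irr: "\<not> les U x x" for x
    unfolding U_laws(13) by (metis U_laws(2,3,4,11))
  show "x < y \<longleftrightarrow> x \<le> y \<and> \<not> y \<le> x" "x \<le> x" "x \<le> y \<Longrightarrow> y \<le> z \<Longrightarrow> x \<le> z"
    "x \<le> y \<Longrightarrow> y \<le> x \<Longrightarrow> x = y"
    unfolding less_eq_elem_def less_elem_def using tr irr by blast+
  show "x \<le> y \<or> y \<le> x"
    unfolding less_eq_elem_def using U_laws(14) by blast
qed
end

lemmas elem_defs = zero_elem_def one_elem_def plus_elem_def times_elem_def less_elem_def

lemma elem_less_iff: "x < y \<longleftrightarrow> (\<exists>z. y = x + (z + 1))" for x y :: elem
  unfolding elem_defs U_laws(13) by (metis U_laws(5))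

lemma elem_diff: "x + y - x = y" for x y :: elem
proof -
  have "x + y = x + z \<longleftrightarrow> y = z" for z
    unfolding elem_defs by (metis U_laws(4))
  then show ?thesis unfolding minus_elem_def by (auto intro: someI2)
qed

instance elem :: comm_semiring_1
proof
  fix x y z :: elem
  show "x + y + z = x + (y + z)" "x * y * z = x * (y * z)" "(x + y) * z = x * z + y * z"
    unfolding elem_defs by (fact U_laws)+
  show "x + y = y + x" "x * y = y * x" "0 + x = x" "1 * x = x"
    unfolding elem_defs by (fact U_laws)+
  show "0 * x = 0" "x * 0 = 0" "(0::elem) \<noteq> 1"
    unfolding elem_defs by (metis U_laws(7,9,11))+
qed

lemma elem_zero_or_plus_one: "x = 0 \<or> (\<exists>y. x = y + 1)" for x :: elem
  unfolding elem_defs using U_laws(5,12) by metis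

lemma elem_le_iff: "x \<le> y \<longleftrightarrow> (\<exists>z. y = x + z)" for x y :: elem
proof -
  show ?thesis unfolding le_less elem_less_iff by (metis add_0_right elem_zero_or_plus_one)
qed

lemma elem_mult_eq_0: "x * y = 0 \<Longrightarrow> x = 0 \<or> y = 0" for x y :: elem
proof (rule ccontr)
  assume "x * y = 0" "\<not> (x = 0 \<or> y = 0)"
  then obtain u w where "x = u + 1" "y = w + 1" using elem_zero_or_plus_one by metis
  then have "(u * w + u + w) + 1 = 0" using \<open>x * y = 0\<close> by (simp add: algebra_simps)
  then show False unfolding elem_defs by (metis U_laws(5,11))
qed

lemma elem_diff_not_le: "\<not> y \<le> x \<Longrightarrow> x - y = 0" for x y :: elem
  by (simp add: minus_elem_def elem_le_iff)

instance elem :: canonically_ordered_monoid_add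
  by standard (rule elem_le_iff)

instance elem :: comm_semiring_1_cancel
proof
  fix x y z :: elem
  show "x + y - x = y" by (rule elem_diff)
  show "x - y - z = x - (y + z)"
  proof (cases "y + z \<le> x")
    case True
    then obtain w where "x = y + z + w" unfolding elem_le_iff by blast
    then show ?thesis by (metis elem_diff add.assoc)
  next
    case False
    show ?thesis
    proof (cases "y \<le> x")
      case True
      then obtain w where w: "x = y + w" unfolding elem_le_iff by blast
      with False have "\<not> z \<le> w" by (auto simp: elem_le_iff add.assoc)
      then show ?thesis using False by (simp add: elem_diff_not_le elem_diff w)
    next
      case 2: False
      have "0 - z = 0"
      proof (cases "z \<le> 0")
        case True
        then show ?thesis using elem_diff[of 0 0] by (simp add: order.antisym)
      qed (rule elem_diff_not_le)
      with False 2 show ?thesis by (simp add: elem_diff_not_le)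
    qed
  qed
  show "x * (y - z) = x * y - x * z"
  proof (cases "z \<le> y")
    case True
    then obtain w where "y = z + w" unfolding elem_le_iff by blast
    then show ?thesis by (simp add: elem_diff distrib_left)
  next
    case False
    then obtain w where "z = y + w" by (metis elem_le_iff linear)
    then have "x * z = x * y + x * w" by (simp add: distrib_left)
    show ?thesis
    proof (cases "x * z \<le> x * y")
      case True
      with \<open>x * z = x * y + x * w\<close> have "x * z = x * y" by (metis elem_le_iff order.antisym)
      then show ?thesis using False elem_diff[of "x * z" 0] by (simp add: elem_diff_not_le)
    qed (use False in \<open>simp add: elem_diff_not_le\<close>)
  qed
qed

instance elem :: linordered_semidom
proof
  fix x y z :: elem
  show "x \<noteq> 0 \<Longrightarrow> y \<noteq> 0 \<Longrightarrow> x * y \<noteq> 0" using elem_mult_eq_0 by blast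
  show "(0::elem) < 1" unfolding elem_less_iff by (rule exI[of _ 0]) simp
  show "y \<le> x \<Longrightarrow> x - y + y = x" unfolding elem_le_iff by (auto simp: elem_diff add.commute)
  show "x < y \<Longrightarrow> 0 < z \<Longrightarrow> z * x < z * y"
    unfolding elem_less_iff[of x] elem_less_iff[of 0] elem_less_iff[of "z * x"]
  proof (elim exE)
    fix u w assume "y = x + (u + 1)" "z = 0 + (w + 1)"
    then have "z * y = z * x + ((w * u + u + w) + 1)" by (simp add: algebra_simps)
    then show "\<exists>u. z * y = z * x + (u + 1)" by blast
  qed
qed

text \<open>Discreteness of the order. It reduces \<open>\<le>\<close> and quantifiers bounded by it
  to the primitive strict order with a term as bound.\<close>

lemma elem_less_plus_one: "x < y + 1 \<longleftrightarrow> x \<le> y" for x y :: elem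
proof
  assume "x < y + 1"
  show "x \<le> y"
  proof (rule ccontr)
    assume "\<not> x \<le> y"
    then obtain z where "x = y + (z + 1)" unfolding not_le elem_less_iff by blast
    then have "x = (y + 1) + z" by (simp add: algebra_simps)
    then have "y + 1 \<le> x" unfolding elem_le_iff by blast
    with \<open>x < y + 1\<close> show False by simp
  qed
qed (rule le_less_trans[OF _ less_add_one])

section \<open>Bounded induction and coding\<close>

lemma Sigma0_subst: "Sigma0 \<phi> \<Longrightarrow> Sigma0 (subst \<sigma> \<phi>)"
proof (induction arbitrary: \<sigma> rule: Sigma0.induct)
  case (5 \<phi> t)
  have "subst \<sigma> (BAll t \<phi>) = BAll (subst_tm \<sigma> t) (subst (lift \<sigma>) \<phi>)"
    unfolding BAll_def by (simp only: subst_Forall subst.simps subst_tm.simps lift_simps subst_tm_lift_shift)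
  then show ?case using 5 by (simp add: Sigma0.intros)
qed (auto intro: Sigma0.intros)

lemma defb_comp:
  assumes "defb M k A" "\<And>i. i < k \<Longrightarrow> deft M k' (f i)"
  shows "defb M k' (\<lambda>v. A (\<lambda>i. f i v))"
proof -
  obtain \<phi> where \<phi>: "Sigma0 \<phi>" "\<And>v. sat M (env k v) \<phi> \<longleftrightarrow> A v"
    using assms(1) unfolding defb_def by blast
  obtain t where t: "\<And>i v. i < k \<Longrightarrow> eval M (env k' v) (t i) = f i v"
    using assms(2) unfolding deft_def by metis
  \<comment> \<open>Argument positions receive the given terms; the parameters, stored from position
    \<open>k\<close> on, are renumbered to start at \<open>k'\<close>.\<close>
  define \<sigma> where "\<sigma> i = (if i < k then t i else Var (i - k + k'))" for i
  have "(\<lambda>i. eval M (env k' v) (\<sigma> i)) = env k (\<lambda>i. f i v)" for v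
    by (auto simp: \<sigma>_def t env_def fun_eq_iff)
  then have "sat M (env k' v) (subst \<sigma> \<phi>) \<longleftrightarrow> A (\<lambda>i. f i v)" for v
    by (simp add: sat_subst \<phi>)
  then show ?thesis unfolding defb_def using Sigma0_subst[OF \<phi>(1)] by blast
qed

lemma deft_Suc: "deft M k f \<Longrightarrow> deft M (Suc k) (\<lambda>v. f (\<lambda>i. v (Suc i)))"
proof -
  assume "deft M k f"
  then obtain t where t: "\<And>v. eval M (env k v) t = f v" unfolding deft_def by blast
  have "(\<lambda>i. env (Suc k) v (i + 1)) = env k (\<lambda>i. v (Suc i))" for v
    by (auto simp: env_def fun_eq_iff)
  then show ?thesis unfolding deft_def by (intro exI[of _ "shift 1 t"]) (simp add: t del: One_nat_def)
qed

lemma defb_comp1: "defb M 1 (\<lambda>v. A (v 0)) \<Longrightarrow> deft M k f \<Longrightarrow> defb M k (\<lambda>v. A (f v))"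
  using defb_comp[of M 1 "\<lambda>v. A (v 0)" k "\<lambda>_. f"] by simp

lemma defb_comp2:
  assumes "defb M 2 (\<lambda>v. A (v 0) (v 1))" "deft M k f" "deft M k g"
  shows "defb M k (\<lambda>v. A (f v) (g v))"
  using defb_comp[of M 2 "\<lambda>v. A (v 0) (v 1)" k "\<lambda>i. if i = 0 then f else g"] assms by simp

abbreviation "term_def \<equiv> deft U"
abbreviation "rel_def \<equiv> defb U"

lemma term_def_plus: "term_def k f \<Longrightarrow> term_def k g \<Longrightarrow> term_def k (\<lambda>v. f v + g v)"
  unfolding plus_elem_def by (rule deft_add)

lemma term_def_times: "term_def k f \<Longrightarrow> term_def k g \<Longrightarrow> term_def k (\<lambda>v. f v * g v)"
  unfolding times_elem_def by (rule deft_mul)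

lemma rel_def_less: "term_def k f \<Longrightarrow> term_def k g \<Longrightarrow> rel_def k (\<lambda>v. f v < g v)"
  unfolding less_elem_def by (rule defb_les)

lemma rel_def_le: "term_def k f \<Longrightarrow> term_def k g \<Longrightarrow> rel_def k (\<lambda>v. f v \<le> g v)"
  unfolding elem_less_plus_one[symmetric] by (intro rel_def_less term_def_plus deft_const)

lemma rel_def_all:
  "term_def k t \<Longrightarrow> rel_def (Suc k) (\<lambda>v. A (\<lambda>i. v (Suc i)) (v 0)) \<Longrightarrow> rel_def k (\<lambda>v. \<forall>x<t v. A v x)"
  unfolding less_elem_def by (rule defb_all)

lemma rel_def_ex:
  "term_def k t \<Longrightarrow> rel_def (Suc k) (\<lambda>v. A (\<lambda>i. v (Suc i)) (v 0)) \<Longrightarrow> rel_def k (\<lambda>v. \<exists>x<t v. A v x)"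
  unfolding less_elem_def by (rule defb_ex)

lemma rel_def_all_le:
  "term_def k t \<Longrightarrow> rel_def (Suc k) (\<lambda>v. A (\<lambda>i. v (Suc i)) (v 0)) \<Longrightarrow> rel_def k (\<lambda>v. \<forall>x\<le>t v. A v x)"
  unfolding elem_less_plus_one[symmetric] by (intro rel_def_all term_def_plus deft_const)

lemma rel_def_ex_le:
  "term_def k t \<Longrightarrow> rel_def (Suc k) (\<lambda>v. A (\<lambda>i. v (Suc i)) (v 0)) \<Longrightarrow> rel_def k (\<lambda>v. \<exists>x\<le>t v. A v x)"
  unfolding elem_less_plus_one[symmetric] by (intro rel_def_ex term_def_plus deft_const)

lemma elem_Suc_le: "x + 1 \<le> y \<longleftrightarrow> x < y" for x y :: elem
  by (metis elem_less_plus_one linorder_not_le)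

lemma elem_one_le: "1 \<le> y \<longleftrightarrow> 0 < y" for y :: elem
  using elem_Suc_le[of 0 y] by simp

text \<open>A quotient by a nonzero divisor is at most \<open>x\<close>, and for
  \<open>m = 0\<close> the quotient 0 will do. The bound makes divisibility a Sigma0
  relation.\<close>

lemma dvd_iff: "m dvd x \<longleftrightarrow> (\<exists>q\<le>x. x = m * q)" for m x :: elem
proof
  assume "m dvd x"
  then obtain q where q: "x = m * q" by blast
  show "\<exists>q\<le>x. x = m * q"
  proof (cases "m = 0")
    case False
    then have "1 \<le> m" by (simp add: elem_one_le zero_less_iff_neq_zero)
    then have "1 * q \<le> m * q" by (rule mult_right_mono) simp
    then show ?thesis using q by auto
  qed (use q in auto)
qed auto

lemma rel_def_dvd: "term_def k f \<Longrightarrow> term_def k g \<Longrightarrow> rel_def k (\<lambda>v. f v dvd g v)"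
  unfolding dvd_iff by (intro rel_def_ex_le defb_eq term_def_times deft_var deft_Suc) auto

text \<open>Keeps the bounds of the formula \<open>Beta\<close>, whose satisfaction therefore
  unfolds to this predicate; \<open>beta_iff\<close> drops the bound on the quotient.\<close>

definition beta :: "elem \<Rightarrow> elem \<Rightarrow> elem \<Rightarrow> elem \<Rightarrow> bool" where
  "beta a b i v \<longleftrightarrow> v < (i + 1) * b + 1 \<and> (\<exists>q<a + 1. a = q * ((i + 1) * b + 1) + v)"

lemma rel_def_beta:
  "term_def k f \<Longrightarrow> term_def k g \<Longrightarrow> term_def k h \<Longrightarrow> term_def k j \<Longrightarrow>
    rel_def k (\<lambda>v. beta (f v) (g v) (h v) (j v))"
  unfolding beta_def
  by (intro defb_and rel_def_less rel_def_ex defb_eq term_def_times term_def_plus deft_const)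
    (assumption | rule deft_var deft_Suc | simp)+

lemma remainder_unique_aux:
  fixes q m v q' w :: elem
  assumes "q * m + v = q' * m + w" "v < m" "q < q'" shows False
proof -
  from assms(3) obtain z where "q' = q + (z + 1)" unfolding elem_less_iff by blast
  with assms(1) have "q * m + v = q * m + (z * m + m + w)" by (simp add: algebra_simps)
  then have "v = z * m + m + w" by (rule add_left_imp_eq)
  then have "m \<le> v" by (metis add.commute add.assoc elem_le_iff)
  with assms(2) show False by simp
qed

lemma remainder_unique:
  fixes q m v q' w :: elem
  assumes "q * m + v = q' * m + w" "v < m" "w < m" shows "v = w"
proof -
  have "q = q'"
    using remainder_unique_aux[OF assms(1,2)] remainder_unique_aux[OF assms(1)[symmetric] assms(3)]
    by (metis linorder_neqE)
  with assms(1) show ?thesis by simp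
qed

lemma le_mult: "0 < m \<Longrightarrow> q \<le> q * m + v" for q m v :: elem
proof -
  assume "0 < m"
  then have "1 \<le> m" by (simp add: elem_one_le)
  then have "q * 1 \<le> q * m" by (rule mult_left_mono) simp
  also have "\<dots> \<le> q * m + v" by (auto simp: elem_le_iff)
  finally show ?thesis by simp
qed

lemma beta_iff: "beta a b i v \<longleftrightarrow> v < (i + 1) * b + 1 \<and> (\<exists>q. a = q * ((i + 1) * b + 1) + v)"
  unfolding beta_def using le_mult[of "(i + 1) * b + 1" _ v]
  by (auto simp: elem_less_plus_one zero_less_iff_neq_zero)

lemma beta_unique: "beta a b i v \<Longrightarrow> beta a b i w \<Longrightarrow> v = w"
  unfolding beta_iff using remainder_unique by metis

text \<open>\<open>U\<close> is guaranteed to be a model of EFA only if a countermodel exists, so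
  whatever needs induction is proved under this assumption.\<close>

locale efa_universe =
  assumes model_U: "model U"
begin

sublocale efa_model U by (rule efa_model.intro[OF model_U])

lemma elem_induct:
  assumes "rel_def 1 (\<lambda>v. A (v 0))" "A 0" "\<And>x. A x \<Longrightarrow> A (x + 1)"
  shows "A x"
proof (rule induct[OF assms(1)])
  show "A (zer U)" using assms(2) unfolding zero_elem_def .
  show "A (suc U x)" if "A x" for x
    using assms(3)[OF that] unfolding plus_elem_def one_elem_def by (metis U_laws(5))
qed

lemmas def_intros = defb_imp defb_not defb_and defb_or defb_iff rel_def_all rel_def_ex rel_def_all_le
  rel_def_ex_le rel_def_less rel_def_le rel_def_dvd rel_def_beta defb_eq term_def_plus term_def_times
  deft_const

lemma least_element:
  assumes "rel_def 1 (\<lambda>v. A (v 0))" "A x"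
  shows "\<exists>m. A m \<and> (\<forall>y<m. \<not> A y)"
proof (rule ccontr)
  assume none: "\<not> ?thesis"
  have "\<forall>y<z. \<not> A y" for z
  proof (rule elem_induct[where A = "\<lambda>z. \<forall>y<z. \<not> A y"])
    show "rel_def 1 (\<lambda>v. \<forall>y<v 0. \<not> A y)"
      by (intro def_intros deft_var defb_comp1[OF assms(1)]) auto
    show "\<forall>y<z + 1. \<not> A y" if "\<forall>y<z. \<not> A y" for z
      using that none by (auto simp: elem_less_plus_one le_less)
  qed simp
  from this[of "x + 1"] show False using assms(2) by simp
qed

text \<open>The least upper bound of \<open>A\<close> belongs to \<open>A\<close>, since otherwise
  its predecessor would be an upper bound too.\<close>

lemma greatest_element:
  assumes "rel_def 1 (\<lambda>v. A (v 0))" "A x" "\<And>y. A y \<Longrightarrow> y \<le> b"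
  shows "\<exists>m. A m \<and> (\<forall>y. A y \<longrightarrow> y \<le> m)"
proof -
  let ?B = "\<lambda>m. \<forall>y\<le>b. A y \<longrightarrow> y \<le> m"
  have "rel_def 1 (\<lambda>v. ?B (v 0))"
    by (intro def_intros deft_var defb_comp1[OF assms(1)]) auto
  then obtain m where m: "?B m" "\<forall>z<m. \<not> ?B z" using least_element[of ?B b] by auto
  have "A m"
  proof (rule ccontr)
    assume "\<not> A m"
    show False
    proof (cases "m = 0")
      case True
      then show False using m(1) assms(2,3) \<open>\<not> A m\<close> by (metis elem_zero_or_plus_one le_zero_eq)
    next
      case False
      then obtain z where z: "m = z + 1" using elem_zero_or_plus_one by blast
      have "?B z" using m(1) \<open>\<not> A m\<close> by (metis elem_less_plus_one le_less z)
      then show False using m(2) z by simp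
    qed
  qed
  then show ?thesis using m(1) assms(3) by blast
qed

lemma division: "0 < m \<Longrightarrow> \<exists>q r. a = q * m + r \<and> r < m" for a m :: elem
proof -
  assume "0 < m"
  have "\<exists>q\<le>a. \<exists>r<m. a = q * m + r"
  proof (rule elem_induct[where A = "\<lambda>a. \<exists>q\<le>a. \<exists>r<m. a = q * m + r"])
    show "rel_def 1 (\<lambda>v. \<exists>q\<le>v 0. \<exists>r<m. v 0 = q * m + r)"
      by (intro def_intros deft_var) auto
    show "\<exists>q\<le>0. \<exists>r<m. 0 = q * m + r" using \<open>0 < m\<close> by auto
    fix a assume "\<exists>q\<le>a. \<exists>r<m. a = q * m + r"
    then obtain q r where qr: "r < m" "a = q * m + r" by blast
    show "\<exists>q\<le>a + 1. \<exists>r<m. a + 1 = q * m + r"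
    proof (cases "r + 1 < m")
      case True
      then show ?thesis using le_mult[OF \<open>0 < m\<close>, of q "r + 1"] qr by (metis add.assoc)
    next
      case False
      then have m: "m = r + 1" using qr(1) by (metis elem_Suc_le le_less)
      then have "a + 1 = (q + 1) * m + 0" unfolding qr(2) m by (simp add: algebra_simps)
      then show ?thesis using le_mult[OF \<open>0 < m\<close>, of "q + 1" 0] \<open>0 < m\<close> by metis
    qed
  qed
  then show ?thesis by blast
qed

text \<open>Total, because remainders always exist: a pair codes an infinite sequence. Definability
  proofs go through its graph \<open>beta\<close>, as \<open>entry\<close> is not a term.\<close>

definition entry :: "elem \<Rightarrow> elem \<Rightarrow> elem \<Rightarrow> elem" where
  "entry a b i = (THE v. beta a b i v)"

lemma beta_entry: "beta a b i v \<longleftrightarrow> entry a b i = v"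
proof -
  have "\<exists>v. beta a b i v" using division[of "(i + 1) * b + 1" a]
    by (auto simp: beta_iff zero_less_iff_neq_zero)
  then have "\<exists>!v. beta a b i v" using beta_unique by blast
  from theI'[OF this] show ?thesis unfolding entry_def using beta_unique by blast
qed

text \<open>Supplies the bound \<open>a\<close> for quantifiers over entries in induction
  formulas.\<close>

lemma entry_le: "entry a b i \<le> a"
proof -
  obtain q where "a = q * ((i + 1) * b + 1) + entry a b i"
    using beta_entry[of a b i "entry a b i"] unfolding beta_iff by blast
  then have "a = entry a b i + q * ((i + 1) * b + 1)" by (simp only: add.commute)
  then show ?thesis unfolding elem_le_iff by blast
qed

end

lemma U_simps [simp]:
  "zer U = 0" "suc U x = x + 1" "add U x y = x + y" "mul U x y = x * y" "les U x y \<longleftrightarrow> x < y"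
  unfolding elem_defs by (simp_all add: U_laws(5)[symmetric])

lemma sat_BAll [simp]: "sat U v (BAll t \<phi>) \<longleftrightarrow> (\<forall>x<eval U v t. sat U (case_nat x v) \<phi>)"
  by (simp add: BAll_def)

lemma sat_BEx [simp]: "sat U v (BEx t \<phi>) \<longleftrightarrow> (\<exists>x<eval U v t. sat U (case_nat x v) \<phi>)"
  by (simp add: BEx_def)

lemma sat_Beta [simp]:
  "sat U v (Beta a b i w) \<longleftrightarrow> beta (eval U v a) (eval U v b) (eval U v i) (eval U v w)"
  by (simp add: Beta_def beta_def)

text \<open>Inverses modulo \<open>m\<close> multiply; \<open>s\<close> and \<open>s'\<close> are
  the cofactors of the modulus.\<close>

lemma mult_unit:
  fixes t P s m :: elem
  assumes "t * P = 1 + s * m" "t' * P' = 1 + s' * m"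
  shows "(t * t') * (P * P') = 1 + (s + s' + s * s' * m) * m"
proof -
  have "(t * t') * (P * P') = (t * P) * (t' * P')" by (simp only: ac_simps)
  then show ?thesis unfolding assms by (simp add: algebra_simps)
qed

section \<open>Powers of two\<close>

context efa_universe
begin

definition pow_code :: "elem \<Rightarrow> elem \<Rightarrow> elem \<Rightarrow> bool" where
  "pow_code a b x \<longleftrightarrow> entry a b 0 = 1 \<and> (\<forall>i<x. entry a b (i + 1) = 2 * entry a b i)"

text \<open>The one place where the truth of the axiom \<open>Exp\<close> is used.\<close>

lemma pow_code_exists: "\<exists>a b. pow_code a b x"
proof -
  have "sat U (\<lambda>_. x) Exp" using model_U by (simp add: model_def EFA_def)
  then show ?thesis by (auto simp: Exp_def Pow2_def pow_code_def beta_entry one_add_one)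
qed

lemma pow_code_unique:
  assumes "pow_code a b x" "pow_code a' b' x'" "i \<le> x" "i \<le> x'"
  shows "entry a b i = entry a' b' i"
proof -
  \<comment> \<open>A common value \<open>w\<close>, bounded by \<open>a\<close>, expresses the
    equality of two entries by a bounded formula.\<close>
  have "i \<le> x \<longrightarrow> i \<le> x' \<longrightarrow> (\<exists>w\<le>a. beta a b i w \<and> beta a' b' i w)"
  proof (rule elem_induct[where A = "\<lambda>i. i \<le> x \<longrightarrow> i \<le> x' \<longrightarrow> (\<exists>w\<le>a. beta a b i w \<and> beta a' b' i w)"])
    show "rel_def 1 (\<lambda>v. v 0 \<le> x \<longrightarrow> v 0 \<le> x' \<longrightarrow> (\<exists>w\<le>a. beta a b (v 0) w \<and> beta a' b' (v 0) w))"
      by (intro def_intros deft_var) auto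
    show "0 \<le> x \<longrightarrow> 0 \<le> x' \<longrightarrow> (\<exists>w\<le>a. beta a b 0 w \<and> beta a' b' 0 w)"
      using assms(1,2) entry_le[of a b 0] by (auto simp: beta_entry pow_code_def)
    show "i + 1 \<le> x \<longrightarrow> i + 1 \<le> x' \<longrightarrow> (\<exists>w\<le>a. beta a b (i + 1) w \<and> beta a' b' (i + 1) w)"
      if "i \<le> x \<longrightarrow> i \<le> x' \<longrightarrow> (\<exists>w\<le>a. beta a b i w \<and> beta a' b' i w)" for i
      using that assms(1,2) entry_le[of a b "i + 1"]
      by (auto simp: beta_entry pow_code_def elem_Suc_le)
  qed
  then show ?thesis using assms(3,4) by (auto simp: beta_entry)
qed

definition e :: "elem \<Rightarrow> elem" where
  "e x = (THE y. \<exists>a b. pow_code a b x \<and> entry a b x = y)"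

lemma pow_code_e:
  assumes "pow_code a b X" "i \<le> X" shows "entry a b i = e i"
proof -
  have "pow_code a b i" using assms by (auto simp: pow_code_def)
  then have "e i = entry a b i"
    unfolding e_def using pow_code_unique by (intro the_equality) blast+
  then show ?thesis ..
qed

text \<open>Provides the parameters through which induction formulas refer to
  \<open>e\<close>.\<close>

lemma e_code: "\<exists>a b. \<forall>i\<le>X. entry a b i = e i"
  using pow_code_exists[of X] pow_code_e by blast

lemma e_0 [simp]: "e 0 = 1"
  using pow_code_exists[of 0] pow_code_e[of _ _ 0 0] by (auto simp: pow_code_def)

lemma e_Suc: "e (x + 1) = 2 * e x"
proof -
  obtain a b where ab: "pow_code a b (x + 1)" using pow_code_exists by blast
  then have "entry a b (x + 1) = 2 * entry a b x" by (auto simp: pow_code_def)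
  then show ?thesis using pow_code_e[OF ab, of x] pow_code_e[OF ab, of "x + 1"] by simp
qed

lemma e_gt: "x < e x"
proof -
  obtain a b where ab: "\<forall>i\<le>x. entry a b i = e i" using e_code by blast
  have "i \<le> x \<longrightarrow> (\<exists>w\<le>a. beta a b i w \<and> i < w)" for i
  proof (rule elem_induct[where A = "\<lambda>i. i \<le> x \<longrightarrow> (\<exists>w\<le>a. beta a b i w \<and> i < w)"])
    show "rel_def 1 (\<lambda>v. v 0 \<le> x \<longrightarrow> (\<exists>w\<le>a. beta a b (v 0) w \<and> v 0 < w))"
      by (intro def_intros deft_var) auto
    show "0 \<le> x \<longrightarrow> (\<exists>w\<le>a. beta a b 0 w \<and> 0 < w)"
      using ab entry_le[of a b 0] by (auto simp: beta_entry)
    fix i assume i: "i \<le> x \<longrightarrow> (\<exists>w\<le>a. beta a b i w \<and> i < w)"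
    show "i + 1 \<le> x \<longrightarrow> (\<exists>w\<le>a. beta a b (i + 1) w \<and> i + 1 < w)"
    proof
      assume le: "i + 1 \<le> x"
      then have "i \<le> x" by (simp add: elem_Suc_le)
      with i ab have "i < e i" by (auto simp: beta_entry)
      then have "i + 1 \<le> e i" by (simp add: elem_Suc_le)
      moreover have "0 < e i" using \<open>i < e i\<close> by (rule le_less_trans[rotated]) simp
      ultimately have "i + 1 < e i + e i" by (metis add_strict_increasing2 add.commute le_less_trans less_add_same_cancel1)
      then have "i + 1 < e (i + 1)" by (simp add: e_Suc mult_2)
      then show "\<exists>w\<le>a. beta a b (i + 1) w \<and> i + 1 < w"
        using ab le entry_le[of a b "i + 1"] by (auto simp: beta_entry)
    qed
  qed
  then show ?thesis using ab by (auto simp: beta_entry)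
qed

lemma e_pos [simp]: "0 < e x"
  using e_gt[of x] by (rule le_less_trans[rotated]) simp

lemma e_add: "e (x + y) = e x * e y"
proof -
  \<comment> \<open>The code reaches \<open>x + y\<close>, so that both \<open>e z\<close> and
    \<open>e (x + z)\<close> are entries for \<open>z \<le> y\<close>.\<close>
  obtain a b where ab: "\<forall>i\<le>x+y. entry a b i = e i" using e_code by blast
  have entries: "entry a b z = e z" "entry a b (x + z) = e (x + z)" if "z \<le> y" for z
  proof -
    have "z \<le> x + y" using that by (metis add.commute add_increasing2 zero_le)
    then show "entry a b z = e z" "entry a b (x + z) = e (x + z)" using ab that by auto
  qed
  have "z \<le> y \<longrightarrow> (\<exists>u\<le>a. \<exists>w\<le>a. beta a b (x + z) u \<and> beta a b z w \<and> u = e x * w)" for z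
  proof (rule elem_induct[where A = "\<lambda>z. z \<le> y \<longrightarrow>
      (\<exists>u\<le>a. \<exists>w\<le>a. beta a b (x + z) u \<and> beta a b z w \<and> u = e x * w)"])
    show "rel_def 1 (\<lambda>v. v 0 \<le> y \<longrightarrow>
        (\<exists>u\<le>a. \<exists>w\<le>a. beta a b (x + v 0) u \<and> beta a b (v 0) w \<and> u = e x * w))"
      by (intro def_intros deft_var) auto
    show "0 \<le> y \<longrightarrow> (\<exists>u\<le>a. \<exists>w\<le>a. beta a b (x + 0) u \<and> beta a b 0 w \<and> u = e x * w)"
      using entries[of 0] entry_le[of a b 0] entry_le[of a b x] by (auto simp: beta_entry)
    fix z assume z: "z \<le> y \<longrightarrow> (\<exists>u\<le>a. \<exists>w\<le>a. beta a b (x + z) u \<and> beta a b z w \<and> u = e x * w)"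
    show "z + 1 \<le> y \<longrightarrow> (\<exists>u\<le>a. \<exists>w\<le>a. beta a b (x + (z + 1)) u \<and> beta a b (z + 1) w \<and> u = e x * w)"
    proof
      assume le: "z + 1 \<le> y"
      then have "z \<le> y" by (simp add: elem_Suc_le)
      with z entries have "e (x + z) = e x * e z" by (auto simp: beta_entry)
      then have "e (x + (z + 1)) = e x * e (z + 1)"
        unfolding add.assoc[symmetric] e_Suc by (simp only: ac_simps)
      then show "\<exists>u\<le>a. \<exists>w\<le>a. beta a b (x + (z + 1)) u \<and> beta a b (z + 1) w \<and> u = e x * w"
        using entries[OF le] entry_le[of a b "z + 1"] entry_le[of a b "x + (z + 1)"]
        by (auto simp: beta_entry)
    qed
  qed
  from this[of y] show ?thesis using entries[of y] by (auto simp: beta_entry)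
qed

lemma e_mono: "x \<le> y \<Longrightarrow> e x \<le> e y"
proof -
  assume "x \<le> y"
  then obtain z where "y = x + z" unfolding elem_le_iff by blast
  moreover have "e x * 1 \<le> e x * e z" by (intro mult_left_mono) (simp_all add: elem_one_le)
  ultimately show ?thesis by (simp add: e_add)
qed

section \<open>Chinese remainder theorem and coding of bounded functions\<close>

lemma common_multiple: "\<exists>d>0. \<forall>k. 0 < k \<longrightarrow> k \<le> n \<longrightarrow> k dvd d" for n :: elem
proof -
  \<comment> \<open>The multiple \<open>D\<close> of \<open>1, ..., k\<close> stays below
    \<open>e (n * k)\<close>, since each new factor \<open>k + 1 \<le> n\<close> is below
    \<open>e n\<close>. The last bound is \<open>e (n * n)\<close>.\<close>
  obtain a b where ab: "\<forall>i\<le>n*n. entry a b i = e i" using e_code by blast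
  let ?A = "\<lambda>k. k \<le> n \<longrightarrow> (\<exists>E\<le>a. beta a b (n * k) E \<and> (\<exists>D\<le>E. 0 < D \<and> (\<forall>i\<le>k. 0 < i \<longrightarrow> i dvd D)))"
  have entries: "entry a b (n * k) = e (n * k)" if "k \<le> n" for k
    using ab that mult_left_mono[of k n n] by simp
  have "?A n"
  proof (rule elem_induct[where A = ?A])
    show "rel_def 1 (\<lambda>v. ?A (v 0))" by (intro def_intros deft_var) auto
    show "?A 0" using entries[of 0] entry_le[of a b 0] by (auto simp: beta_entry intro!: exI[of _ 1])
    fix k assume k: "?A k"
    show "?A (k + 1)"
    proof
      assume le: "k + 1 \<le> n"
      then have "k \<le> n" by (simp add: elem_Suc_le)
      with k entries obtain D where D: "D \<le> e (n * k)" "0 < D" "\<forall>i\<le>k. 0 < i \<longrightarrow> i dvd D"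
        by (auto simp: beta_entry)
      have "k + 1 \<le> e n" using le e_gt[of n] by simp
      then have "D * (k + 1) \<le> e (n * k) * e n" using D(1) by (intro mult_mono) auto
      then have "D * (k + 1) \<le> e (n * (k + 1))" by (simp add: e_add distrib_left)
      moreover have "i dvd D * (k + 1)" if "i \<le> k + 1" "0 < i" for i
        using D(3) that by (metis dvd_triv_right dvd_mult2 elem_less_plus_one le_less)
      moreover have "0 < D * (k + 1)" using D(2) by (intro mult_pos_pos) (auto simp: add_nonneg_pos)
      ultimately show "\<exists>E\<le>a. beta a b (n * (k + 1)) E \<and> (\<exists>D\<le>E. 0 < D \<and> (\<forall>i\<le>k + 1. 0 < i \<longrightarrow> i dvd D))"
        using entries[OF le] entry_le[of a b "n * (k + 1)"]
        by (intro exI[of _ "e (n * (k + 1))"]) (auto simp: beta_entry)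
    qed
  qed
  then show ?thesis by auto
qed

text \<open>Invertibility of \<open>P\<close> modulo \<open>m\<close>. The bounds on inverse and
  cofactor keep it Sigma0, and by \<open>unitI\<close> they can be met whenever
  \<open>1 < m\<close>.\<close>

definition unit :: "elem \<Rightarrow> elem \<Rightarrow> bool" where
  "unit P m \<longleftrightarrow> (\<exists>t<m. \<exists>s\<le>P. t * P = 1 + s * m)"

lemma unitI:
  assumes eq: "t * P = 1 + s * m" and m: "1 < m"
  shows "unit P m"
proof -
  have "0 < m" using m by (rule le_less_trans[rotated]) simp
  obtain q t' where t': "t = q * m + t'" "t' < m" using division[OF \<open>0 < m\<close>] by blast
  obtain w u where w: "t' * P = w * m + u" "u < m" using division[OF \<open>0 < m\<close>] by blast
  \<comment> \<open>Both sides are \<open>t * P\<close> divided by \<open>m\<close>;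
    \<open>1 < m\<close> admits 1 as a remainder.\<close>
  have "(q * P + w) * m + u = s * m + 1"
    using eq w(1) by (simp add: t' algebra_simps)
  then have u: "u = 1" using remainder_unique w(2) m by blast
  have "w \<le> P"
  proof (rule ccontr)
    assume "\<not> w \<le> P"
    then have "P * m \<le> w * m" by (intro mult_right_mono) auto
    moreover have "t' * P \<le> m * P" using t'(2) by (intro mult_right_mono) auto
    ultimately have "t' * P \<le> w * m" by (metis mult.commute order.trans)
    then show False by (simp add: w(1) u)
  qed
  then show ?thesis unfolding unit_def using t'(2) w(1) u by (metis add.commute)
qed

lemma unit_mult: "unit P m \<Longrightarrow> unit P' m \<Longrightarrow> 1 < m \<Longrightarrow> unit (P * P') m"
  unfolding unit_def[of P] unit_def[of P'] using mult_unit unitI by blast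

text \<open>The moduli \<open>m\<^sub>i = (i + 1) d + 1\<close> satisfy \<open>(l + 1) m\<^sub>i - (i + 1) m\<^sub>l = l - i\<close> and \<open>l - i\<close> divides \<open>d\<close>, hence
  \<open>(l + 1) d = m\<^sub>l - 1\<close>, which makes \<open>m\<^sub>i\<close> invertible modulo \<open>m\<^sub>l\<close>.\<close>

lemma unit_moduli:
  assumes d: "\<And>k. 0 < k \<Longrightarrow> k \<le> n \<Longrightarrow> k dvd d" "0 < d" and il: "i \<le> n" "l \<le> n" "i \<noteq> l"
  shows "unit ((i + 1) * d + 1) ((l + 1) * d + 1)"
proof -
  have gt: "1 < (l + 1) * d + 1" using d(2) by (simp add: add_nonneg_pos)
  consider "i < l" | "l < i" using il(3) by force
  then show ?thesis
  proof cases
    case 1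
    then obtain z where z: "l = i + (z + 1)" unfolding elem_less_iff by blast
    have "z + 1 \<le> l" unfolding z elem_le_iff by (metis add.commute)
    then have "z + 1 dvd d" using d(1)[of "z + 1"] il(2) by (simp add: add_nonneg_pos)
    then obtain q where q: "d = (z + 1) * q" by blast
    \<comment> \<open>The identity times \<open>q * (l + 1)\<close> says that \<open>x\<close> times
      the modulus of \<open>i\<close> is -1 modulo that of \<open>l\<close>. Since \<open>g\<close>
      is -1 as well, \<open>x * g\<close> is the inverse.\<close>
    define g where "g = (l + 1) * d"
    define y where "y = q * (i + 1) * (l + 1) + 1"
    define x where "x = q * (l + 1) * (l + 1)"
    have *: "x * ((i + 1) * d + 1) + 1 = y * (g + 1)"
      unfolding x_def g_def y_def q z by (simp add: algebra_simps)
    have "0 < y * g" unfolding g_def y_def using d(2) by (intro mult_pos_pos) (auto simp: add_nonneg_pos)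
    then obtain w where w: "y * g = w + 1" using elem_zero_or_plus_one[of "y * g"] by auto
    have "(x * g) * ((i + 1) * d + 1) + g = g * (x * ((i + 1) * d + 1) + 1)"
      by (simp add: distrib_left ac_simps)
    also have "\<dots> = (y * g) * (g + 1)" unfolding * by (simp only: ac_simps)
    also have "\<dots> = (1 + w * (g + 1)) + g" unfolding w by (simp add: algebra_simps)
    finally have "(x * g) * ((i + 1) * d + 1) = 1 + w * (g + 1)" by (rule add_right_imp_eq)
    then show ?thesis using unitI gt unfolding g_def by blast
  next
    case 2
    then obtain z where z: "i = l + (z + 1)" unfolding elem_less_iff by blast
    have "z + 1 \<le> i" unfolding z elem_le_iff by (metis add.commute)
    then have "z + 1 dvd d" using d(1)[of "z + 1"] il(1) by (simp add: add_nonneg_pos)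
    then obtain q where q: "d = (z + 1) * q" by blast
    \<comment> \<open>The difference now has the opposite sign, so the same product is already 1;
      adding the modulus to both sides avoids subtraction.\<close>
    define y where "y = q * (i + 1) * (l + 1)"
    have "0 < q" using d(2) unfolding q by (auto simp: zero_less_iff_neq_zero)
    then have "0 < y" unfolding y_def by (intro mult_pos_pos) (auto simp: add_nonneg_pos)
    then obtain w where w: "y = w + 1" using elem_zero_or_plus_one[of y] by auto
    have "(q * (l + 1) * (l + 1)) * ((i + 1) * d + 1) + ((l + 1) * d + 1) = 1 + y * ((l + 1) * d + 1)"
      unfolding y_def q z by (simp add: algebra_simps)
    also have "\<dots> = (1 + w * ((l + 1) * d + 1)) + ((l + 1) * d + 1)"
      unfolding w by (simp only: distrib_right mult_1_left ac_simps)
    finally have "(q * (l + 1) * (l + 1)) * ((i + 1) * d + 1) = 1 + w * ((l + 1) * d + 1)"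
      by (rule add_right_imp_eq)
    then show ?thesis using unitI gt by blast
  qed
qed

lemma chinese_step:
  assumes "unit P m" "c < P" "r < m"
  shows "\<exists>c'<P * m. (\<exists>u. c' = c + u * P) \<and> (\<exists>q. c' = q * m + r)"
proof -
  have m: "0 < m" using assms(3) by (rule le_less_trans[rotated]) simp
  obtain t s where ts: "t * P = 1 + s * m" using assms(1) unfolding unit_def by blast
  obtain q0 c0 where c0: "c = q0 * m + c0" "c0 < m" using division[OF m] by blast
  \<comment> \<open>In the absence of negative numbers \<open>r + c1\<close> stands for
    \<open>r - c\<close> modulo \<open>m\<close>. Times the inverse \<open>t\<close> it tells how
    often \<open>P\<close> must be added; reducing this to \<open>u < m\<close> keeps the solution
    below \<open>P * m\<close>.\<close>
  obtain c1 where c1: "m = c0 + c1" using c0(2) unfolding elem_less_iff by blast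
  define w where "w = r + c1"
  obtain q1 u where u: "w * t = q1 * m + u" "u < m" using division[OF m] by blast
  obtain z r' where z: "c + u * P = z * m + r'" "r' < m" using division[OF m] by blast
  have "(q1 * P + z) * m + r' = q1 * m * P + (c + u * P)"
    unfolding z(1) by (simp add: algebra_simps)
  also have "\<dots> = c + (q1 * m + u) * P" by (simp add: algebra_simps)
  also have "\<dots> = c + w * (t * P)" unfolding u(1)[symmetric] by (simp only: ac_simps)
  also have "\<dots> = (q0 + 1 + w * s) * m + r"
    unfolding ts unfolding c0(1) w_def by (simp add: c1 algebra_simps)
  finally have "r' = r" using remainder_unique z(2) assms(3) by blast
  moreover have "c + u * P < P * m"
  proof -
    have "c + u * P < P + u * P" using assms(2) by simp
    also have "\<dots> = (u + 1) * P" by (simp add: algebra_simps)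
    also have "\<dots> \<le> m * P" using u(2) by (intro mult_right_mono) (auto simp: elem_Suc_le)
    finally show ?thesis by (simp add: mult.commute)
  qed
  ultimately show ?thesis using z(1) by blast
qed

lemma coding:
  assumes f: "rel_def 2 (\<lambda>v. f (v 0) = v 1)" and V: "\<And>i. i < n \<Longrightarrow> f i \<le> V"
  shows "\<exists>c d. \<forall>i<n. entry c d i = f i"
proof -
  obtain d0 where d0: "0 < d0" "\<And>k. 0 < k \<Longrightarrow> k \<le> n \<Longrightarrow> k dvd d0" using common_multiple[of n] by blast
  \<comment> \<open>The factor \<open>V + 1\<close> makes every modulus exceed the values to be
    coded and preserves divisibility by all \<open>k \<le> n\<close>.\<close>
  define d where "d = d0 * (V + 1)"
  define m where "m i = (i + 1) * d + 1" for i
  have d: "0 < d" "\<And>k. 0 < k \<Longrightarrow> k \<le> n \<Longrightarrow> k dvd d"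
    using d0 by (auto simp: d_def add_nonneg_pos intro: mult_pos_pos)
  have "1 * (V + 1) \<le> d0 * (V + 1)" using d0(1) by (intro mult_right_mono) (auto simp: elem_one_le)
  then have "V < d" by (simp add: d_def elem_Suc_le)
  have m_gt: "V < m i" "1 < m i" "0 < m i" for i
  proof -
    have "1 * d \<le> (i + 1) * d" by (intro mult_right_mono) auto
    then have "d < m i" unfolding m_def by (simp add: elem_less_plus_one)
    then show "V < m i" using \<open>V < d\<close> by simp
    show "1 < m i" using \<open>d < m i\<close> d(1) by (metis elem_one_le le_less_trans)
    then show "0 < m i" by (rule le_less_trans[rotated]) simp
  qed
  \<comment> \<open>An upper bound of the moduli in use; a product of \<open>k\<close> of them is at
    most \<open>e (Q * k)\<close>.\<close>
  define Q where "Q = n * d + 1"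
  have m_le: "m i \<le> e Q" if "i < n" for i
  proof -
    have "(i + 1) * d \<le> n * d" using that by (intro mult_right_mono) (auto simp: elem_Suc_le)
    then have "m i \<le> Q" by (simp add: m_def Q_def)
    then show ?thesis using e_gt[of Q] by simp
  qed
  obtain a b where ab: "\<forall>i\<le>Q*n. entry a b i = e i" using e_code by blast
  have entries: "entry a b (Q * k) = e (Q * k)" if "k \<le> n" for k
    using ab that mult_left_mono[of k n Q] by simp
  \<comment> \<open>Invariant after \<open>k\<close> entries: \<open>c\<close> solves the first
    \<open>k\<close> congruences, and \<open>P\<close> stands for the product of their moduli,
    recorded only as a multiple of these that is invertible modulo the others. Moduli and
    \<open>unit\<close> are spelled out for the definability proof; \<open>B_iff\<close> folds them
    back.\<close>
  let ?B = "\<lambda>k P. 0 < P \<and> (\<exists>c<P. (\<forall>i<k. \<exists>w\<le>V. f i = w \<and> beta c d i w) \<and> (\<forall>i<k. (i + 1) * d + 1 dvd P)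
    \<and> (\<forall>i<n. k \<le> i \<longrightarrow> (\<exists>t<(i + 1) * d + 1. \<exists>s\<le>P. t * P = 1 + s * ((i + 1) * d + 1))))"
  let ?A = "\<lambda>k. k \<le> n \<longrightarrow> (\<exists>E\<le>a. beta a b (Q * k) E \<and> (\<exists>P\<le>E. ?B k P))"
  have B_iff: "?B k P \<longleftrightarrow> 0 < P \<and> (\<exists>c<P. (\<forall>i<k. beta c d i (f i)) \<and> (\<forall>i<k. m i dvd P)
      \<and> (\<forall>i<n. k \<le> i \<longrightarrow> unit P (m i)))" if "k \<le> n" for k P
    unfolding unit_def m_def using that V by (auto 4 3)
  have "?A n"
  proof (rule elem_induct[where A = ?A])
    show "rel_def 1 (\<lambda>v. ?A (v 0))"
      by (intro def_intros defb_comp2[OF f] deft_var) auto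
    have "unit 1 (m i)" for i using m_gt by (intro unitI[of 1 1 0]) auto
    then have "?B 0 1" by (subst B_iff) (auto intro!: exI[of _ 0])
    then show "?A 0" using entries[of 0] entry_le[of a b 0] by (auto simp: beta_entry)
    fix k assume k: "?A k"
    show "?A (k + 1)"
    proof
      assume le: "k + 1 \<le> n"
      then have kn: "k \<le> n" "k < n" by (simp_all add: elem_Suc_le)
      with k entries obtain P where P: "P \<le> e (Q * k)" "?B k P"
        by (auto simp: beta_entry)
      then obtain c where c: "0 < P" "c < P" "\<And>i. i < k \<Longrightarrow> beta c d i (f i)" "\<And>i. i < k \<Longrightarrow> m i dvd P"
        "\<And>i. i < n \<Longrightarrow> k \<le> i \<Longrightarrow> unit P (m i)"
        unfolding B_iff[OF kn(1)] by blast
      have "f k < m k" using V[OF kn(2)] m_gt(1) by (rule le_less_trans)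
      with chinese_step[OF c(5)[OF kn(2) order.refl] c(2)]
      obtain c' u q where c': "c' < P * m k" "c' = c + u * P" "c' = q * m k + f k" by blast
      have "beta c' d i (f i)" if "i < k + 1" for i
      proof (cases "i = k")
        case True
        then show ?thesis using c'(3) \<open>f k < m k\<close> unfolding beta_iff m_def by blast
      next
        case False
        with that have "i < k" by (simp add: elem_less_plus_one)
        then obtain q z where "c = q * m i + f i" "P = m i * z" "f i < m i"
          using c(3,4) unfolding beta_iff m_def by (meson dvdE)
        \<comment> \<open>Adding multiples of \<open>P\<close> preserves the earlier remainders,
          because \<open>m i\<close> divides \<open>P\<close>.\<close>
        then have "c' = (q + u * z) * m i + f i" unfolding c'(2) by (simp add: algebra_simps)
        then show ?thesis using \<open>f i < m i\<close> unfolding beta_iff m_def by blast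
      qed
      moreover have "m i dvd P * m k" if "i < k + 1" for i
        using that c(4) by (metis dvd_mult2 dvd_triv_right elem_less_plus_one le_less)
      moreover have "unit (P * m k) (m i)" if "i < n" "k + 1 \<le> i" for i
      proof (rule unit_mult)
        show "unit P (m i)" using that by (intro c(5)) (simp_all add: elem_Suc_le)
        show "unit (m k) (m i)"
          unfolding m_def using that kn by (intro unit_moduli d) (auto simp: elem_Suc_le)
      qed (rule m_gt)
      moreover have "0 < P * m k" using c(1) m_gt by simp
      ultimately have "?B (k + 1) (P * m k)" unfolding B_iff[OF le] using c'(1) by blast
      moreover have "P * m k \<le> e (Q * k) * e Q" using P(1) m_le[OF kn(2)] by (rule mult_mono) auto
      then have "P * m k \<le> e (Q * (k + 1))" by (simp add: e_add distrib_left)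
      ultimately show "\<exists>E\<le>a. beta a b (Q * (k + 1)) E \<and> (\<exists>P\<le>E. ?B (k + 1) P)"
        using entries[OF le] entry_le[of a b "Q * (k + 1)"] unfolding beta_entry by metis
    qed
  qed
  then obtain P where "?B n P" by auto
  then show ?thesis unfolding B_iff[OF order.refl] beta_entry by blast
qed

end

section \<open>Homogeneous sets with small gaps\<close>

context efa_universe
begin

lemma levels:
  "\<exists>c d. entry c d 0 = 1 \<and> (\<forall>j<r. entry c d (j + 1) = entry c d j * e k * entry c d j)"
proof -
  \<comment> \<open>\<open>X\<close> bounds the exponents of \<open>L 0, ..., L r\<close>; the code
    reaches \<open>X + r\<close> in order to contain the inner powers \<open>e j\<close> as
    well.\<close>
  define X where "X = k * e r"
  obtain a b where ab: "\<forall>i\<le>X + r. entry a b i = e i" using e_code by blast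
  define L where "L j = e (k * (e j - 1))" for j
  \<comment> \<open>Cut off beyond \<open>r\<close>, where the code need not supply the powers that
    define \<open>L\<close>.\<close>
  define f where "f j = (if j \<le> r then L j else 0)" for j
  have level: "k * (e j - 1) + k = k * e j" for j
  proof -
    have "k * (e j - 1 + 1) = k * e j" by (subst le_add_diff_inverse2) (simp_all add: elem_one_le)
    then show ?thesis by (simp add: distrib_left)
  qed
  have level_le: "k * (e j - 1) \<le> X" if "j \<le> r" for j
  proof -
    have "k * (e j - 1) \<le> k * (e j - 1) + k" by simp
    also have "\<dots> \<le> X" unfolding level X_def using e_mono[OF that] by (rule mult_left_mono) simp
    finally show ?thesis .
  qed
  \<comment> \<open>Here \<open>w\<close> is the inner power \<open>e x\<close>, and
    \<open>p + k = k * w\<close> describes the exponent \<open>k * (w - 1)\<close> without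
    subtraction.\<close>
  have "f x = y \<longleftrightarrow> (x \<le> r \<longrightarrow> (\<exists>w\<le>a. beta a b x w \<and> (\<exists>p\<le>X. p + k = k * w \<and> beta a b p y)))
      \<and> (\<not> x \<le> r \<longrightarrow> y = 0)" for x y
  proof (cases "x \<le> r")
    case True
    then have x: "entry a b x = e x" using ab by (simp add: add_increasing)
    have "p + k = k * e x \<longleftrightarrow> p = k * (e x - 1)" for p
      unfolding level[symmetric] by simp
    moreover have "entry a b (k * (e x - 1)) = L x"
      unfolding L_def using level_le[OF True] ab by (simp add: add_increasing2)
    ultimately show ?thesis using True level_le[OF True] entry_le[of a b x]
      by (auto simp: beta_entry x f_def)
  qed (auto simp: f_def)
  moreover have "rel_def 2 (\<lambda>v. (v 0 \<le> r \<longrightarrow> (\<exists>w\<le>a. beta a b (v 0) w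
      \<and> (\<exists>p\<le>X. p + k = k * w \<and> beta a b p (v 1)))) \<and> (\<not> v 0 \<le> r \<longrightarrow> v 1 = 0))"
    by (intro def_intros deft_var) auto
  ultimately have "rel_def 2 (\<lambda>v. f (v 0) = v 1)" by simp
  moreover have "f j \<le> e X" for j
    using level_le[of j] by (simp add: f_def L_def e_mono)
  ultimately obtain c d where "\<forall>j<r + 1. entry c d j = f j" using coding[of f "r + 1" "e X"] by blast
  then have cd: "entry c d j = L j" if "j \<le> r" for j
    using that by (simp add: elem_less_plus_one f_def)
  have "L (j + 1) = L j * e k * L j" for j
  proof -
    \<comment> \<open>With \<open>e j = u + 1\<close>, doubling gives
      \<open>e (j + 1) - 1 = 2 * u + 1\<close>, so the exponent \<open>k * u\<close> becomes
      \<open>k * u + k + k * u\<close>.\<close>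
    obtain u where u: "e j = u + 1" using elem_zero_or_plus_one[of "e j"] e_pos[of j] by (metis less_irrefl)
    have "e (j + 1) = (u + u + 1) + 1" unfolding e_Suc u mult_2 by (simp only: ac_simps)
    then have "e (j + 1) - 1 = u + u + 1" by (simp only: add_diff_cancel_right')
    moreover have "e j - 1 = u" unfolding u by (simp only: add_diff_cancel_right')
    ultimately show ?thesis unfolding L_def by (simp add: distrib_left e_add ac_simps)
  qed
  then show ?thesis using cd[of 0] cd
    by (intro exI[of _ c] exI[of _ d]) (auto simp: L_def elem_Suc_le)
qed

text \<open>If no color meets all blocks, the colors are eliminated one after the other: an interval of
  length \<open>L (j + 1)\<close> is cut into blocks of length \<open>L j\<close>, one of which misses the next color. After
  all \<open>r\<close> colors an interval of length \<open>L 0 = 1\<close> without any color remains.\<close>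

lemma color_in_all_blocks:
  "\<exists>n. \<forall>a b. (\<forall>x<n. entry a b x < r) \<longrightarrow> (\<exists>j<r. \<exists>s l. 0 < l \<and> s + l * e k * l \<le> n
    \<and> (\<forall>t<l * e k. \<exists>x. s + t * l \<le> x \<and> x < s + (t + 1) * l \<and> entry a b x = j))"
proof -
  obtain c d where L0: "entry c d 0 = 1"
    and L_Suc: "\<And>j. j < r \<Longrightarrow> entry c d (j + 1) = entry c d j * e k * entry c d j"
    using levels[of r k] by blast
  define L where "L = entry c d"
  have L_pos: "j \<le> r \<longrightarrow> (\<exists>w\<le>c. beta c d j w \<and> 0 < w)" for j
  proof (rule elem_induct[where A = "\<lambda>j. j \<le> r \<longrightarrow> (\<exists>w\<le>c. beta c d j w \<and> 0 < w)"])
    show "rel_def 1 (\<lambda>v. v 0 \<le> r \<longrightarrow> (\<exists>w\<le>c. beta c d (v 0) w \<and> 0 < w))"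
      by (intro def_intros deft_var) auto
    show "0 \<le> r \<longrightarrow> (\<exists>w\<le>c. beta c d 0 w \<and> 0 < w)"
      using L0 entry_le[of c d 0] by (auto simp: beta_entry)
    show "j + 1 \<le> r \<longrightarrow> (\<exists>w\<le>c. beta c d (j + 1) w \<and> 0 < w)"
      if "j \<le> r \<longrightarrow> (\<exists>w\<le>c. beta c d j w \<and> 0 < w)" for j
      using that L_Suc[of j] entry_le[of c d "j + 1"] by (auto simp: beta_entry elem_Suc_le)
  qed
  define n where "n = L r"
  show ?thesis
  proof (rule exI[of _ n], intro allI impI, rule ccontr)
    fix a b
    assume C: "\<forall>x<n. entry a b x < r"
      and none: "\<not> (\<exists>j<r. \<exists>s l. 0 < l \<and> s + l * e k * l \<le> n
        \<and> (\<forall>t<l * e k. \<exists>x. s + t * l \<le> x \<and> x < s + (t + 1) * l \<and> entry a b x = j))"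
    \<comment> \<open>Colors are eliminated in increasing order, so \<open>i \<le> y\<close>
      expresses that the first \<open>i\<close> of them are absent from an interval of length
      \<open>L u\<close>, where \<open>u\<close> is the number of colors left.\<close>
    let ?A = "\<lambda>i. i \<le> r \<longrightarrow> (\<exists>u\<le>r. u + i = r \<and> (\<exists>w\<le>c. beta c d u w \<and> (\<exists>s\<le>n. s + w \<le> n
      \<and> (\<forall>x<n. s \<le> x \<longrightarrow> x < s + w \<longrightarrow> (\<exists>y\<le>a. beta a b x y \<and> i \<le> y)))))"
    have A_iff: "?A i \<longleftrightarrow> (i \<le> r \<longrightarrow> (\<exists>u. u + i = r \<and> (\<exists>s. s + L u \<le> n
      \<and> (\<forall>x. s \<le> x \<longrightarrow> x < s + L u \<longrightarrow> i \<le> entry a b x))))" for i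
    proof -
      have "u \<le> r" if "u + i = r" for u using that by (metis elem_le_iff)
      moreover have "s \<le> n" "x < s + w \<Longrightarrow> x < n" if "s + w \<le> n" for s x w
        using that by (metis add_increasing2 order.trans order.refl zero_le, auto)
      ultimately show ?thesis unfolding beta_entry L_def using entry_le by (metis (no_types, lifting))
    qed
    have "?A r"
    proof (rule elem_induct[where A = ?A])
      show "rel_def 1 (\<lambda>v. ?A (v 0))" by (intro def_intros deft_var) auto
      show "?A 0" unfolding A_iff using n_def by (auto intro!: exI[of _ 0])
      fix i assume "?A i"
      have "\<exists>u. u + (i + 1) = r \<and> (\<exists>s. s + L u \<le> n
          \<and> (\<forall>x. s \<le> x \<longrightarrow> x < s + L u \<longrightarrow> i + 1 \<le> entry a b x))" if "i + 1 \<le> r"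
      proof -
        from that have "i < r" by (simp add: elem_Suc_le)
        with \<open>?A i\<close> obtain u s where u: "u + i = r" and s: "s + L u \<le> n"
          "\<And>x. s \<le> x \<Longrightarrow> x < s + L u \<Longrightarrow> i \<le> entry a b x"
          unfolding A_iff by auto
        from u \<open>i < r\<close> obtain j where j: "u = j + 1" using elem_zero_or_plus_one[of u] by auto
        then have jr: "j + (i + 1) = r" using u by (simp add: ac_simps)
        then have "j < r" unfolding elem_less_iff by blast
        define l where "l = L j"
        have l: "L u = l * e k * l" unfolding j l_def L_def by (rule L_Suc[OF \<open>j < r\<close>])
        have "0 < l" using L_pos[of j] \<open>j < r\<close> by (auto simp: l_def L_def beta_entry)
        with none \<open>i < r\<close> s(1) obtain t where t: "t < l * e k"
          "\<And>x. s + t * l \<le> x \<Longrightarrow> x < s + (t + 1) * l \<Longrightarrow> entry a b x \<noteq> i"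
          unfolding l by blast
        have "(t + 1) * l \<le> l * e k * l" using t(1) by (intro mult_right_mono) (simp_all add: elem_Suc_le)
        then have le: "s + (t + 1) * l \<le> s + L u" unfolding l by simp
        have eq: "s + (t + 1) * l = s + t * l + l" by (simp add: algebra_simps)
        have "i + 1 \<le> entry a b x" if "s + t * l \<le> x" "x < s + t * l + l" for x
        proof -
          have "s \<le> x" using that(1) by (metis add_increasing2 order.trans order.refl zero_le)
          moreover have "x < s + L u" using that(2) le unfolding eq by (rule less_le_trans)
          ultimately have "i \<le> entry a b x" by (rule s(2))
          moreover have "entry a b x \<noteq> i" using t(2) that unfolding eq by blast
          ultimately show ?thesis by (simp add: elem_Suc_le)
        qed
        moreover have "s + t * l + l \<le> n" using le s(1) unfolding eq by (rule order.trans)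
        ultimately show ?thesis using jr unfolding l_def by blast
      qed
      then show "?A (i + 1)" unfolding A_iff by blast
    qed
    then obtain u s where "u + r = r" "s + L u \<le> n" "\<And>x. s \<le> x \<Longrightarrow> x < s + L u \<Longrightarrow> r \<le> entry a b x"
      unfolding A_iff by blast
    moreover from this(1) have "L u = 1" using L0 by (simp add: L_def)
    ultimately have "s < n" "r \<le> entry a b s" by (simp_all add: elem_Suc_le)
    then show False using C by auto
  qed
qed

section \<open>Semantic counterparts of the formulas and the homogeneous set\<close>

definition homogeneous :: "elem \<Rightarrow> elem \<Rightarrow> elem \<Rightarrow> elem \<Rightarrow> elem \<Rightarrow> elem \<Rightarrow> bool" where
  "homogeneous a b r c d n \<longleftrightarrow> (\<forall>x<n. \<forall>y<n. entry c d x = 1 \<longrightarrow> entry c d y = 1 \<longrightarrow>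
    entry a b x < r \<and> entry a b y = entry a b x)"

definition card_code :: "elem \<Rightarrow> elem \<Rightarrow> elem \<Rightarrow> elem \<Rightarrow> elem \<Rightarrow> elem \<Rightarrow> bool" where
  "card_code c d n l p q \<longleftrightarrow> (\<forall>i<l. entry p q i < n \<and> entry c d (entry p q i) = 1)
    \<and> (\<forall>i<l. \<forall>j<l. entry p q i = entry p q j \<longrightarrow> i = j)
    \<and> (\<forall>x<n. entry c d x = 1 \<longrightarrow> (\<exists>i<l. entry p q i = x))"

text \<open>Phrased with \<open>beta\<close> because it enters a definability proof, where the
  largest gap is found; the bound \<open>n\<close> on the two elements is left to the
  context.\<close>

definition consecutive :: "elem \<Rightarrow> elem \<Rightarrow> elem \<Rightarrow> elem \<Rightarrow> bool" where
  "consecutive c d x y \<longleftrightarrow> beta c d x 1 \<and> beta c d y 1 \<and> x < y \<and> (\<forall>z<y. x < z \<longrightarrow> \<not> beta c d z 1)"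

definition gap_size :: "elem \<Rightarrow> elem \<Rightarrow> elem \<Rightarrow> elem \<Rightarrow> bool" where
  "gap_size c d n g \<longleftrightarrow>
    (\<forall>x<n. \<forall>y<n. beta c d x 1 \<and> beta c d y 1 \<longrightarrow> x = y) \<and> g = 1
    \<or> (\<exists>x<n. \<exists>y<n. consecutive c d x y \<and> y = x + g)
      \<and> (\<forall>x<n. \<forall>y<n. consecutive c d x y \<longrightarrow> y \<le> x + g)"

lemma large_homogeneous:
  assumes T: "T = l * e (m + 1)" and "0 < m" "0 < l" "j < r" and n: "s + T * l \<le> n"
    and blocks: "\<forall>t<T. \<exists>x. s + t * l \<le> x \<and> x < s + (t + 1) * l \<and> entry a b x = j"
  shows "\<exists>c d. homogeneous a b r c d n
    \<and> (\<exists>l g. (\<exists>p q. card_code c d n l p q) \<and> gap_size c d n g \<and> m * g < l)"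
proof -
  \<comment> \<open>Origin of the exponent \<open>m + 1\<close>: \<open>m < e m\<close> doubles to
    \<open>2 * (m + 1) \<le> e (m + 1)\<close>.\<close>
  have "2 * m + 1 < e (m + 1)"
  proof -
    have "m + 1 \<le> e m" using e_gt[of m] by (simp add: elem_Suc_le)
    then have "2 * (m + 1) \<le> e (m + 1)" unfolding e_Suc by (rule mult_left_mono) simp
    moreover have "2 * m + 1 < 2 * (m + 1)" by (simp add: distrib_left)
    ultimately show ?thesis by (rule less_le_trans[rotated])
  qed
  have mT: "m * (2 * l) < T"
  proof -
    have "2 * m < e (m + 1)" using \<open>2 * m + 1 < e (m + 1)\<close> by (rule le_less_trans[rotated]) simp
    then have "l * (2 * m) < l * e (m + 1)" using \<open>0 < l\<close>
      by (rule mult_strict_left_mono)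
    then show ?thesis unfolding T by (simp add: ac_simps)
  qed
  \<comment> \<open>With at least two blocks there are consecutive elements, so the gap size is a
    genuine difference.\<close>
  have "1 < T"
  proof -
    have "1 < e (m + 1)" using \<open>2 * m + 1 < e (m + 1)\<close> by (rule le_less_trans[rotated]) simp
    also have "1 * e (m + 1) \<le> T" unfolding T
      using \<open>0 < l\<close> by (intro mult_right_mono) (auto simp: elem_one_le)
    finally show ?thesis by simp
  qed
  \<comment> \<open>The first element of color \<open>j\<close> from the start of block
    \<open>t\<close> on. That it lies inside the block follows from \<open>blocks\<close> and
    minimality.\<close>
  define P where "P t x \<longleftrightarrow> s + t * l \<le> x \<and> beta a b x j \<and> (\<forall>y<x. \<not> (s + t * l \<le> y \<and> beta a b y j))" for t x
  define h where "h t = (if t < T then THE x. P t x else 0)" for t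
  have P_unique: "x = y" if "P t x" "P t y" for t x y
    using that unfolding P_def by (metis linorder_neqE)
  have h: "P t (h t)" "h t < s + (t + 1) * l" if "t < T" for t
  proof -
    obtain x where x: "s + t * l \<le> x" "x < s + (t + 1) * l" "entry a b x = j" using blocks \<open>t < T\<close> by blast
    have "rel_def 1 (\<lambda>v. s + t * l \<le> v 0 \<and> beta a b (v 0) j)" by (intro def_intros deft_var) auto
    from least_element[OF this, of x] x obtain y where y: "P t y"
      unfolding P_def by (auto simp: beta_entry)
    then have "h t = y" unfolding h_def using \<open>t < T\<close> P_unique by (auto intro: the_equality)
    with y show "P t (h t)" by simp
    have "\<not> x < y" using y x(1,3) unfolding P_def beta_entry by blast
    then have "y \<le> x" by simp
    then show "h t < s + (t + 1) * l" using \<open>h t = y\<close> x(2) by simp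
  qed
  have h_bounds: "s + t * l \<le> h t" "h t < s + (t + 1) * l" "h t < n" "entry a b (h t) = j" if "t < T" for t
  proof -
    have "(t + 1) * l \<le> T * l" using that by (intro mult_right_mono) (simp_all add: elem_Suc_le)
    then have "s + (t + 1) * l \<le> n" using n by (meson add_left_mono order.trans)
    then show "h t < n" using h(2)[OF that] by simp
  qed (use h[OF that] in \<open>auto simp: P_def beta_entry\<close>)
  have h_mono: "h t < h t'" if "t < t'" "t' < T" for t t'
  proof -
    have "(t + 1) * l \<le> t' * l" using that by (intro mult_right_mono) (simp_all add: elem_Suc_le)
    then have "s + (t + 1) * l \<le> s + t' * l" by simp
    then show ?thesis using h_bounds(1)[of t'] h_bounds(2)[of t] that by (meson less_le_trans less_trans)
  qed
  have h_less: "h t < h t' \<longleftrightarrow> t < t'" if "t < T" "t' < T" for t t'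
    using h_mono that by (metis less_asym linorder_neqE less_irrefl)
  have "h t = x \<longleftrightarrow> (t < T \<longrightarrow> P t x) \<and> (\<not> t < T \<longrightarrow> x = 0)" for t x
    using h(1) P_unique by (auto simp: h_def)
  moreover have "rel_def 2 (\<lambda>v. (v 0 < T \<longrightarrow> P (v 0) (v 1)) \<and> (\<not> v 0 < T \<longrightarrow> v 1 = 0))"
    unfolding P_def by (intro def_intros deft_var) auto
  ultimately have "rel_def 2 (\<lambda>v. h (v 0) = v 1)" by simp
  \<comment> \<open>This code lists the set without repetition, so it later witnesses
    \<open>card_code\<close> as well.\<close>
  then obtain p q where pq: "\<forall>t<T. entry p q t = h t"
    using coding[of h T n] h_bounds(3) by (meson less_imp_le)
  define \<chi> :: "elem \<Rightarrow> elem" where "\<chi> x = (if \<exists>t<T. beta p q t x then 1 else 0)" for x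
  have "\<chi> x = y \<longleftrightarrow> ((\<exists>t<T. beta p q t x) \<longrightarrow> y = 1) \<and> (\<not> (\<exists>t<T. beta p q t x) \<longrightarrow> y = 0)" for x y
    by (auto simp: \<chi>_def)
  moreover have "rel_def 2 (\<lambda>v. ((\<exists>t<T. beta p q t (v 0)) \<longrightarrow> v 1 = 1) \<and> (\<not> (\<exists>t<T. beta p q t (v 0)) \<longrightarrow> v 1 = 0))"
    by (intro def_intros deft_var) auto
  ultimately have "rel_def 2 (\<lambda>v. \<chi> (v 0) = v 1)" by simp
  moreover have "\<chi> x \<le> 1" for x by (simp add: \<chi>_def)
  ultimately obtain c d where "\<forall>x<n. entry c d x = \<chi> x" using coding[of \<chi> n 1] by blast
  then have cd: "entry c d x = 1 \<longleftrightarrow> (\<exists>t<T. h t = x)" if "x < n" for x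
    using that pq by (auto simp: \<chi>_def beta_entry)
  \<comment> \<open>\<open>h\<close> enumerates the set increasingly, so neighbors in the set are
    neighbors in the enumeration.\<close>
  have cons: "x < n \<and> y < n \<and> consecutive c d x y \<longleftrightarrow> (\<exists>t. t + 1 < T \<and> x = h t \<and> y = h (t + 1))" for x y
  proof
    assume xy: "x < n \<and> y < n \<and> consecutive c d x y"
    then obtain t t' where t: "x = h t" "y = h t'" "t < T" "t' < T" "h t < h t'"
      using cd unfolding consecutive_def beta_entry by metis
    then have "t + 1 \<le> t'" using h_less by (simp add: elem_Suc_le)
    have "\<not> t + 1 < t'"
    proof
      assume "t + 1 < t'"
      then have "t + 1 < T" "h t < h (t + 1)" "h (t + 1) < h t'" using h_mono t(3,4) by auto
      then show False using xy t(1,2) cd h_bounds(3) unfolding consecutive_def beta_entry by blast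
    qed
    with \<open>t + 1 \<le> t'\<close> t show "\<exists>t. t + 1 < T \<and> x = h t \<and> y = h (t + 1)" by (metis le_less)
  next
    assume "\<exists>t. t + 1 < T \<and> x = h t \<and> y = h (t + 1)"
    then obtain t where t: "t + 1 < T" "x = h t" "y = h (t + 1)" by blast
    then have "t < T" by (rule_tac le_less_trans[of t "t + 1"]) auto
    have "\<not> (h t < z \<and> z < h (t + 1) \<and> entry c d z = 1)" for z
    proof
      assume z: "h t < z \<and> z < h (t + 1) \<and> entry c d z = 1"
      then have "z < n" using h_bounds(3)[OF t(1)] by (meson less_trans)
      then obtain t' where "t' < T" "z = h t'" using z cd by blast
      then have "t < t'" "t' < t + 1" using z h_less \<open>t < T\<close> t(1) by auto
      then show False by (simp add: elem_less_plus_one)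
    qed
    then show "x < n \<and> y < n \<and> consecutive c d x y"
      using t h_bounds(3) cd h_mono[of t "t + 1"] \<open>t < T\<close> unfolding consecutive_def beta_entry by auto
  qed
  \<comment> \<open>One element may lie at the start of its block and the next at the end of the
    following block, hence \<open>2 * l\<close> and not \<open>l\<close>.\<close>
  have gap: "y \<le> x + 2 * l" if "x < n" "y < n" "consecutive c d x y" for x y
  proof -
    from that obtain t where t: "t + 1 < T" "x = h t" "y = h (t + 1)" using cons by blast
    then have "t < T" by (rule_tac le_less_trans[of t "t + 1"]) auto
    have "y < s + (t + 1 + 1) * l" using h_bounds(2)[OF t(1)] t(3) by simp
    also have "\<dots> = (s + t * l) + 2 * l"
      by (simp only: mult_2 distrib_right mult_1_left add.assoc)
    also have "\<dots> \<le> x + 2 * l" using h_bounds(1)[OF \<open>t < T\<close>] t(2) by simp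
    finally show ?thesis by simp
  qed
  have gap_le: "g \<le> 2 * l" if "\<exists>x<n. \<exists>y<n. consecutive c d x y \<and> y = x + g" for g
  proof -
    from that obtain x where "x < n" "x + g < n" "consecutive c d x (x + g)" by blast
    then have "x + g \<le> x + 2 * l" by (rule gap)
    then show ?thesis by simp
  qed
  \<comment> \<open>The attained differences form a Sigma0 set bounded by \<open>2 * l\<close>. A
    largest one must come from bounded induction, as the set is finite only in the sense of the
    model.\<close>
  let ?G = "\<lambda>g. \<exists>x<n. \<exists>y<n. consecutive c d x y \<and> y = x + g"
  have "rel_def 1 (\<lambda>v. ?G (v 0))"
    unfolding consecutive_def by (intro def_intros deft_var) auto
  moreover have "\<exists>g. ?G g"
  proof -
    have "h 0 < n \<and> h (0 + 1) < n \<and> consecutive c d (h 0) (h (0 + 1))"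
      using \<open>1 < T\<close> cons by (metis add_0)
    moreover from this obtain g where "h (0 + 1) = h 0 + (g + 1)"
      unfolding consecutive_def elem_less_iff by blast
    ultimately show ?thesis by blast
  qed
  ultimately obtain g where g: "?G g" "\<And>g'. ?G g' \<Longrightarrow> g' \<le> g"
    using greatest_element[of ?G _ "2 * l"] gap_le by blast
  have "y \<le> x + g" if "x < n" "y < n" "consecutive c d x y" for x y
  proof -
    from that obtain g' where g': "y = x + (g' + 1)" unfolding consecutive_def elem_less_iff by blast
    with that have "g' + 1 \<le> g" by (intro g(2)) blast
    then show ?thesis unfolding g' by (rule add_left_mono)
  qed
  moreover have "m * g < T"
  proof -
    have "m * g \<le> m * (2 * l)" using gap_le[OF g(1)] by (rule mult_left_mono) simp
    then show ?thesis using mT by simp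
  qed
  moreover have "card_code c d n T p q"
    using pq cd h_bounds(3) h_mono unfolding card_code_def by (metis less_irrefl linorder_neqE)
  moreover have "homogeneous a b r c d n"
    using cd h_bounds(4) \<open>j < r\<close> unfolding homogeneous_def by metis
  ultimately show ?thesis using g(1) unfolding gap_size_def by blast
qed

section \<open>Evaluation of the formalized statement in \<open>U\<close>\<close>

lemma eval_shift_case_nat:
  "eval M v (shift 0 t) = eval M v t"
  "eval M (case_nat x v) (shift (Suc k) t) = eval M v (shift k t)"
  by simp_all

text \<open>Peels one shift per quantifier and so returns each term to the outer valuation. The rule
  \<open>eval_shift\<close> would leave shifted valuations and is switched off below.\<close>

lemmas eval_shift_simps = eval_shift_case_nat eval_nat_numeral

lemma sat_Mem:
  "sat U v (Mem x c d n) \<longleftrightarrow>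
    eval U v x < eval U v n \<and> beta (eval U v c) (eval U v d) (eval U v x) 1"
  by (simp add: Mem_def)

lemma sat_Coloring:
  "sat U v (Coloring a b n r) \<longleftrightarrow>
    (\<forall>x<eval U v n. entry (eval U v a) (eval U v b) x < eval U v r)"
  by (simp add: Coloring_def beta_entry eval_shift_simps del: eval_shift)

lemma sat_Homogeneous:
  "sat U v (Homogeneous a b r c d n) \<longleftrightarrow>
    homogeneous (eval U v a) (eval U v b) (eval U v r) (eval U v c) (eval U v d) (eval U v n)"
  by (auto simp: Homogeneous_def homogeneous_def sat_Mem beta_entry eval_shift_simps simp del: eval_shift)

lemma sat_Card:
  "sat U v (Card c d n l) \<longleftrightarrow>
    (\<exists>p q. card_code (eval U v c) (eval U v d) (eval U v n) (eval U v l) p q)"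
  by (simp add: Card_def card_code_def sat_Mem beta_entry eval_shift_simps del: eval_shift)
    (intro ex_cong1 conj_cong; blast)

lemma sat_Consecutive:
  "sat U v (Consecutive x y c d n) \<longleftrightarrow> eval U v x < eval U v n \<and> eval U v y < eval U v n
    \<and> consecutive (eval U v c) (eval U v d) (eval U v x) (eval U v y)"
  by (auto simp: Consecutive_def consecutive_def sat_Mem eval_shift_simps simp del: eval_shift)

lemma sat_Gap_Size:
  "sat U v (Gap_Size c d n g) \<longleftrightarrow> gap_size (eval U v c) (eval U v d) (eval U v n) (eval U v g)"
  by (auto simp: Gap_Size_def gap_size_def sat_Consecutive sat_Mem elem_less_plus_one eval_shift_simps
      simp del: eval_shift)

lemma sat_BL_sentence: "sat U v BL_sentence"
proof -
  have "\<exists>n. \<forall>a b. (\<forall>x<n. entry a b x < r) \<longrightarrow> (\<exists>c d. homogeneous a b r c d n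
      \<and> (\<exists>l g. (\<exists>p q. card_code c d n l p q) \<and> gap_size c d n g \<and> m * g < l))" if "0 < m" for m r
  proof -
    obtain n where n: "\<forall>a b. (\<forall>x<n. entry a b x < r) \<longrightarrow> (\<exists>j<r. \<exists>s l. 0 < l \<and> s + l * e (m + 1) * l \<le> n
      \<and> (\<forall>t<l * e (m + 1). \<exists>x. s + t * l \<le> x \<and> x < s + (t + 1) * l \<and> entry a b x = j))"
      using color_in_all_blocks by blast
    show ?thesis
    proof (rule exI[of _ n], intro allI impI)
      fix a b assume "\<forall>x<n. entry a b x < r"
      with n obtain j s l where "j < r" "0 < l" "s + l * e (m + 1) * l \<le> n"
        "\<forall>t<l * e (m + 1). \<exists>x. s + t * l \<le> x \<and> x < s + (t + 1) * l \<and> entry a b x = j" by blast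
      then show "\<exists>c d. homogeneous a b r c d n
          \<and> (\<exists>l g. (\<exists>p q. card_code c d n l p q) \<and> gap_size c d n g \<and> m * g < l)"
        by (intro large_homogeneous[OF refl \<open>0 < m\<close>])
    qed
  qed
  then show ?thesis
    by (simp add: BL_sentence_def BL_def sat_Coloring sat_Homogeneous sat_Card sat_Gap_Size eval_nat_numeral)
qed

end

text \<open>A countermodel would make \<open>U\<close> itself a model of EFA with a refuting
  valuation, contrary to \<open>sat_BL_sentence\<close>.\<close>

theorem theorem6p5:
  "EFA \<turnstile> Forall (Zero \<^bold>< Var 0 \<^bold>\<longrightarrow> BL (Var 1 \<^bold>* Var 0))"
  using EFA_complete[of BL_sentence] U(2) efa_universe.sat_BL_sentence efa_universe.intro
  unfolding BL_sentence_def by blast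

end
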